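(* Let $G$ be a group acting on a monoidal triangulated category $\mathbf{K}$ which is left or right rigid and such that $\operatorname{Spc}\mathbf{K}$ is a Noetherian topological space. Then the map $c_2:(\operatorname{Spc}\mathbf{K})/G\to G\text{-}\operatorname{Spc}\mathbf{K}$ given by $G.\mathbf{P}\mapsto(\mathbf{P}:G)$ is bijective.
   Context: A monoidal triangulated category is a triangulated category $\mathbf{K}$ with a monoidal structure $(\otimes,\mathbf{1})$ such that $\otimes$ is exact in each variable; no braiding is assumed. It is left (right) rigid if every object has a left (right) dual. An action of a group $G$ on $\mathbf{K}$ consists of autoequivalences of monoidal triangulated categories $T_g:\mathbf{K}\to\mathbf{K}$ (monoidal and triangulated), $g\in G$, and natural isomorphisms (of monoidal triangulated functors) $\gamma_{g,h}:T_gT_h\cong T_{gh}$ with $\gamma_{g,hk}\circ T_g\gamma_{h,k}=\gamma_{gh,k}\circ\gamma_{g,h}T_k$ for all $g,h,k\in G$. All subcategories are full and closed under isomorphism. A thick ideal is a triangulated subcategory closed under direct summands and under $\otimes$ on both sides with arbitrary objects. A prime ideal is a proper thick ideal $\mathbf{P}$ such that $\mathbf{I}\otimes\mathbf{J}\subseteq\mathbf{P}$ implies $\mathbf{I}\subseteq\mathbf{P}$ or $\mathbf{J}\subseteq\mathbf{P}$ for thick ideals $\mathbf{I},\mathbf{J}$ (equivalently, $A\otimes\mathbf{K}\otimes B\subseteq\mathbf{P}$ implies $A\in\mathbf{P}$ or $B\in\mathbf{P}$). $\operatorname{Spc}\mathbf{K}$ is the set of prime ideals, with closed sets $V(\mathbf{S})=\{\mathbf{P}:\mathbf{S}\cap\mathbf{P}=\varnothing\}$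 for collections $\mathbf{S}$ of objects. For a thick ideal $\mathbf{I}$, $T_g\mathbf{I}=\{T_gA:A\in\mathbf{I}\}$ (up to isomorphism). $G$ acts on $\operatorname{Spc}\mathbf{K}$ by $g.\mathbf{P}=T_g\mathbf{P}$; $G.\mathbf{P}$ denotes the orbit of $\mathbf{P}$ and $(\operatorname{Spc}\mathbf{K})/G$ the set of orbits. A $G$-ideal of $\mathbf{K}$ is a thick ideal $\mathbf{I}$ with $T_g\mathbf{I}\subseteq\mathbf{I}$ for all $g\in G$. A $G$-prime is a proper $G$-ideal $\mathbf{Q}$ such that for all $G$-ideals $\mathbf{I},\mathbf{J}$, $\mathbf{I}\otimes\mathbf{J}\subseteq\mathbf{Q}$ implies $\mathbf{I}\subseteq\mathbf{Q}$ or $\mathbf{J}\subseteq\mathbf{Q}$. $G\text{-}\operatorname{Spc}\mathbf{K}$ is the set of $G$-primes. The $G$-core $(\mathbf{I}:G)$ of a thick ideal $\mathbf{I}$ is the largest $G$-ideal contained in $\mathbf{I}$; explicitly $(\mathbf{I}:G)=\bigcap_{g\in G}T_g\mathbf{I}$. If $\mathbf{P}$ is prime then $(\mathbf{P}:G)$ is a $G$-prime, depending only on the orbit $G.\mathbf{P}$. *)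

theory Defs
  imports "HOL-Algebra.Group_Action" "HOL-Analysis.Abstract_Topology"
begin

section \<open>Categories, endofunctors, natural isomorphisms\<close>

record ('o, 'm) cat =
  Ob :: "'o set"
  Ar :: "'m set"
  Dom :: "'m \<Rightarrow> 'o"
  Cod :: "'m \<Rightarrow> 'o"
  Idn :: "'o \<Rightarrow> 'm"
  Cmp :: "'m \<Rightarrow> 'm \<Rightarrow> 'm"  (infixl "\<cdot>\<index>" 70)  \<comment> \<open>\<open>g \<cdot> f\<close> is \<open>g\<close> after \<open>f\<close>\<close>

definition Hom :: "('o, 'm, 'z) cat_scheme \<Rightarrow> 'o \<Rightarrow> 'o \<Rightarrow> 'm set" where
  "Hom K A B = {f \<in> Ar K. Dom K f = A \<and> Cod K f = B}"

locale category =
  fixes K :: "('o, 'm, 'z) cat_scheme" (structure)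
  assumes Dom_Ob: "f \<in> Ar K \<Longrightarrow> Dom K f \<in> Ob K"
    and Cod_Ob: "f \<in> Ar K \<Longrightarrow> Cod K f \<in> Ob K"
    and Idn_Hom: "A \<in> Ob K \<Longrightarrow> Idn K A \<in> Hom K A A"
    and Cmp_Hom: "\<lbrakk>f \<in> Hom K A B; g \<in> Hom K B C\<rbrakk> \<Longrightarrow> g \<cdot> f \<in> Hom K A C"
    and Idn_left: "f \<in> Hom K A B \<Longrightarrow> Idn K B \<cdot> f = f"
    and Idn_right: "f \<in> Hom K A B \<Longrightarrow> f \<cdot> Idn K A = f"
    and Cmp_assoc: "\<lbrakk>f \<in> Hom K A B; g \<in> Hom K B C; h \<in> Hom K C D\<rbrakk>
      \<Longrightarrow> (h \<cdot> g) \<cdot> f = h \<cdot> (g \<cdot> f)"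

definition inverse_ar :: "('o, 'm, 'z) cat_scheme \<Rightarrow> 'm \<Rightarrow> 'm \<Rightarrow> bool" where
  "inverse_ar K f g \<longleftrightarrow> f \<in> Ar K \<and> g \<in> Hom K (Cod K f) (Dom K f) \<and>
     g \<cdot>\<^bsub>K\<^esub> f = Idn K (Dom K f) \<and> f \<cdot>\<^bsub>K\<^esub> g = Idn K (Cod K f)"

definition Iso :: "('o, 'm, 'z) cat_scheme \<Rightarrow> 'o \<Rightarrow> 'o \<Rightarrow> 'm set" where
  "Iso K A B = {f \<in> Hom K A B. \<exists>g. inverse_ar K f g}"

definition inv_ar :: "('o, 'm, 'z) cat_scheme \<Rightarrow> 'm \<Rightarrow> 'm" where
  "inv_ar K f = (THE g. inverse_ar K f g)"

definition isomorphic :: "('o, 'm, 'z) cat_scheme \<Rightarrow> 'o \<Rightarrow> 'o \<Rightarrow> bool" where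
  "isomorphic K A B \<longleftrightarrow> Iso K A B \<noteq> {}"

definition zero_object :: "('o, 'm, 'z) cat_scheme \<Rightarrow> 'o \<Rightarrow> bool" where
  "zero_object K Z \<longleftrightarrow> Z \<in> Ob K \<and>
     (\<forall>A\<in>Ob K. (\<exists>!f. f \<in> Hom K Z A) \<and> (\<exists>!f. f \<in> Hom K A Z))"

record ('o, 'm) efun =
  Fo :: "'o \<Rightarrow> 'o"
  Fa :: "'m \<Rightarrow> 'm"

definition endofunctor :: "('o, 'm, 'z) cat_scheme \<Rightarrow> ('o, 'm, 'y) efun_scheme \<Rightarrow> bool" where
  "endofunctor K F \<longleftrightarrow>
     (\<forall>A\<in>Ob K. Fo F A \<in> Ob K) \<and>
     (\<forall>A B. \<forall>f\<in>Hom K A B. Fa F f \<in> Hom K (Fo F A) (Fo F B)) \<and>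
     (\<forall>A\<in>Ob K. Fa F (Idn K A) = Idn K (Fo F A)) \<and>
     (\<forall>A B C. \<forall>f\<in>Hom K A B. \<forall>g\<in>Hom K B C. Fa F (g \<cdot>\<^bsub>K\<^esub> f) = Fa F g \<cdot>\<^bsub>K\<^esub> Fa F f)"

definition fun_id :: "('o, 'm) efun" where
  "fun_id = \<lparr>Fo = (\<lambda>A. A), Fa = (\<lambda>f. f)\<rparr>"

definition fun_comp ::
  "('o, 'm, 'x) efun_scheme \<Rightarrow> ('o, 'm, 'y) efun_scheme \<Rightarrow> ('o, 'm) efun" where
  "fun_comp F F' = \<lparr>Fo = (\<lambda>A. Fo F (Fo F' A)), Fa = (\<lambda>f. Fa F (Fa F' f))\<rparr>"

definition nat_iso ::
  "('o, 'm, 'z) cat_scheme \<Rightarrow> ('o, 'm, 'x) efun_scheme \<Rightarrow> ('o, 'm, 'y) efun_scheme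
    \<Rightarrow> ('o \<Rightarrow> 'm) \<Rightarrow> bool" where
  "nat_iso K F F' \<eta> \<longleftrightarrow>
     (\<forall>A\<in>Ob K. \<eta> A \<in> Iso K (Fo F A) (Fo F' A)) \<and>
     (\<forall>A B. \<forall>f\<in>Hom K A B. \<eta> B \<cdot>\<^bsub>K\<^esub> Fa F f = Fa F' f \<cdot>\<^bsub>K\<^esub> \<eta> A)"

definition autoequivalence ::
  "('o, 'm, 'z) cat_scheme \<Rightarrow> ('o, 'm, 'y) efun_scheme \<Rightarrow> bool" where
  "autoequivalence K F \<longleftrightarrow> endofunctor K F \<and>
     (\<exists>(F' :: ('o, 'm) efun) \<eta> \<epsilon>. endofunctor K F' \<and>
        nat_iso K fun_id (fun_comp F' F) \<eta> \<and> nat_iso K (fun_comp F F') fun_id \<epsilon>)"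


section \<open>Additive categories\<close>

record ('o, 'm) addcat = "('o, 'm) cat" +
  Add :: "'m \<Rightarrow> 'm \<Rightarrow> 'm"  (infixl "\<boxplus>\<index>" 65)
  Zero :: "'o \<Rightarrow> 'o \<Rightarrow> 'm"

definition hom_group :: "('o, 'm, 'z) addcat_scheme \<Rightarrow> 'o \<Rightarrow> 'o \<Rightarrow> 'm monoid" where
  "hom_group K A B = \<lparr>carrier = Hom K A B, monoid.mult = Add K, one = Zero K A B\<rparr>"

definition Neg :: "('o, 'm, 'z) addcat_scheme \<Rightarrow> 'm \<Rightarrow> 'm" where
  "Neg K f = inv\<^bsub>hom_group K (Dom K f) (Cod K f)\<^esub> f"

text \<open>\<open>E\<close>, with injections \<open>i\<close>, \<open>j\<close> and projections \<open>p\<close>, \<open>q\<close>, is a direct sum of \<open>A\<close> and \<open>B\<close>.\<close>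

definition biproduct :: "('o, 'm, 'z) addcat_scheme \<Rightarrow> 'o \<Rightarrow> 'o \<Rightarrow> 'o
    \<Rightarrow> 'm \<Rightarrow> 'm \<Rightarrow> 'm \<Rightarrow> 'm \<Rightarrow> bool" where
  "biproduct K A B E i j p q \<longleftrightarrow>
     i \<in> Hom K A E \<and> j \<in> Hom K B E \<and> p \<in> Hom K E A \<and> q \<in> Hom K E B \<and>
     p \<cdot>\<^bsub>K\<^esub> i = Idn K A \<and> q \<cdot>\<^bsub>K\<^esub> j = Idn K B \<and>
     q \<cdot>\<^bsub>K\<^esub> i = Zero K A B \<and> p \<cdot>\<^bsub>K\<^esub> j = Zero K B A \<and>
     (i \<cdot>\<^bsub>K\<^esub> p) \<boxplus>\<^bsub>K\<^esub> (j \<cdot>\<^bsub>K\<^esub> q) = Idn K E"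

locale additive_category = category K
  for K :: "('o, 'm, 'z) addcat_scheme" (structure) +
  assumes hom_comm_group: "\<lbrakk>A \<in> Ob K; B \<in> Ob K\<rbrakk> \<Longrightarrow> comm_group (hom_group K A B)"
    and Cmp_Add_left: "\<lbrakk>f \<in> Hom K A B; f' \<in> Hom K A B; g \<in> Hom K B C\<rbrakk>
      \<Longrightarrow> g \<cdot> (f \<boxplus> f') = (g \<cdot> f) \<boxplus> (g \<cdot> f')"
    and Cmp_Add_right: "\<lbrakk>f \<in> Hom K A B; g \<in> Hom K B C; g' \<in> Hom K B C\<rbrakk>
      \<Longrightarrow> (g \<boxplus> g') \<cdot> f = (g \<cdot> f) \<boxplus> (g' \<cdot> f)"
    and ex_zero_object: "\<exists>Z. zero_object K Z"
    and ex_biproduct: "\<lbrakk>A \<in> Ob K; B \<in> Ob K\<rbrakk> \<Longrightarrow> \<exists>E\<in>Ob K. \<exists>i j p q. biproduct K A B E i j p q"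

definition additive_functor ::
  "('o, 'm, 'z) addcat_scheme \<Rightarrow> ('o, 'm, 'y) efun_scheme \<Rightarrow> bool" where
  "additive_functor K F \<longleftrightarrow> endofunctor K F \<and>
     (\<forall>A B. \<forall>f\<in>Hom K A B. \<forall>g\<in>Hom K A B. Fa F (f \<boxplus>\<^bsub>K\<^esub> g) = Fa F f \<boxplus>\<^bsub>K\<^esub> Fa F g)"


section \<open>Triangulated categories\<close>

text \<open>The shift is an additive autoequivalence, not necessarily an automorphism.
  A triple \<open>(f, g, h)\<close> in \<open>Dist K\<close> is a distinguished triangle
  \<open>A \<rightarrow> B \<rightarrow> C \<rightarrow> \<Sigma> A\<close>.\<close>

record ('o, 'm) tricat = "('o, 'm) addcat" +
  Sh :: "('o, 'm) efun"
  Dist :: "('m \<times> 'm \<times> 'm) set"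

definition triangle ::
  "('o, 'm, 'z) tricat_scheme \<Rightarrow> 'o \<Rightarrow> 'o \<Rightarrow> 'o \<Rightarrow> 'm \<Rightarrow> 'm \<Rightarrow> 'm \<Rightarrow> bool" where
  "triangle K A B C f g h \<longleftrightarrow>
     f \<in> Hom K A B \<and> g \<in> Hom K B C \<and> h \<in> Hom K C (Fo (Sh K) A)"

definition dtriangle ::
  "('o, 'm, 'z) tricat_scheme \<Rightarrow> 'o \<Rightarrow> 'o \<Rightarrow> 'o \<Rightarrow> 'm \<Rightarrow> 'm \<Rightarrow> 'm \<Rightarrow> bool" where
  "dtriangle K A B C f g h \<longleftrightarrow> triangle K A B C f g h \<and> (f, g, h) \<in> Dist K"

locale triangulated_category = additive_category K
  for K :: "('o, 'm, 'z) tricat_scheme" (structure) +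
  assumes shift_equiv: "autoequivalence K (Sh K)"
    and shift_additive: "additive_functor K (Sh K)"
    and Dist_triangle: "(f, g, h) \<in> Dist K \<Longrightarrow> \<exists>A B C. triangle K A B C f g h"
    and TR1_iso: "\<lbrakk>dtriangle K A B C f g h; triangle K A' B' C' f' g' h';
        a \<in> Iso K A A'; b \<in> Iso K B B'; c \<in> Iso K C C';
        b \<cdot> f = f' \<cdot> a; c \<cdot> g = g' \<cdot> b; Fa (Sh K) a \<cdot> h = h' \<cdot> c\<rbrakk>
      \<Longrightarrow> dtriangle K A' B' C' f' g' h'"
    and TR1_id: "\<lbrakk>A \<in> Ob K; zero_object K Z\<rbrakk>
      \<Longrightarrow> dtriangle K A A Z (Idn K A) (Zero K A Z) (Zero K Z (Fo (Sh K) A))"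
    and TR1_cone: "f \<in> Hom K A B \<Longrightarrow> \<exists>C g h. dtriangle K A B C f g h"
    and TR2: "triangle K A B C f g h \<Longrightarrow>
      dtriangle K A B C f g h \<longleftrightarrow>
      dtriangle K B C (Fo (Sh K) A) g h (Neg K (Fa (Sh K) f))"
    and TR3: "\<lbrakk>dtriangle K A B C f g h; dtriangle K A' B' C' f' g' h';
        a \<in> Hom K A A'; b \<in> Hom K B B'; b \<cdot> f = f' \<cdot> a\<rbrakk>
      \<Longrightarrow> \<exists>c\<in>Hom K C C'. c \<cdot> g = g' \<cdot> b \<and> Fa (Sh K) a \<cdot> h = h' \<cdot> c"
    and TR4: "\<lbrakk>dtriangle K A B D f i i'; dtriangle K B C F g j j';
        dtriangle K A C E (g \<cdot> f) k k'\<rbrakk>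
      \<Longrightarrow> \<exists>u v. dtriangle K D E F u v (Fa (Sh K) i \<cdot> j') \<and>
            u \<cdot> i = k \<cdot> g \<and> k' \<cdot> u = i' \<and> v \<cdot> k = j \<and> j' \<cdot> v = Fa (Sh K) f \<cdot> k'"

definition exact_functor ::
  "('o, 'm, 'z) tricat_scheme \<Rightarrow> ('o, 'm, 'y) efun_scheme \<Rightarrow> ('o \<Rightarrow> 'm) \<Rightarrow> bool" where
  "exact_functor K F \<phi> \<longleftrightarrow> additive_functor K F \<and>
     nat_iso K (fun_comp F (Sh K)) (fun_comp (Sh K) F) \<phi> \<and>
     (\<forall>A B C f g h. dtriangle K A B C f g h \<longrightarrow>
        dtriangle K (Fo F A) (Fo F B) (Fo F C) (Fa F f) (Fa F g) (\<phi> A \<cdot>\<^bsub>K\<^esub> Fa F h))"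


section \<open>Monoidal triangulated categories\<close>

record ('o, 'm) mtcat = "('o, 'm) tricat" +
  Tob :: "'o \<Rightarrow> 'o \<Rightarrow> 'o"  (infixl "\<boxtimes>\<index>" 75)
  Tar :: "'m \<Rightarrow> 'm \<Rightarrow> 'm"  (infixl "\<star>\<index>" 75)
  Unit :: "'o"
  Asc :: "'o \<Rightarrow> 'o \<Rightarrow> 'o \<Rightarrow> 'm"
  Lun :: "'o \<Rightarrow> 'm"
  Run :: "'o \<Rightarrow> 'm"

locale monoidal_category = category K
  for K :: "('o, 'm, 'z) mtcat_scheme" (structure) +
  assumes Tob_Ob: "\<lbrakk>A \<in> Ob K; B \<in> Ob K\<rbrakk> \<Longrightarrow> A \<boxtimes> B \<in> Ob K"
    and Tar_Hom: "\<lbrakk>f \<in> Hom K A A'; g \<in> Hom K B B'\<rbrakk> \<Longrightarrow> f \<star> g \<in> Hom K (A \<boxtimes> B) (A' \<boxtimes> B')"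
    and Tar_Idn: "\<lbrakk>A \<in> Ob K; B \<in> Ob K\<rbrakk> \<Longrightarrow> Idn K A \<star> Idn K B = Idn K (A \<boxtimes> B)"
    and Tar_Cmp: "\<lbrakk>f \<in> Hom K A A'; f' \<in> Hom K A' A''; g \<in> Hom K B B'; g' \<in> Hom K B' B''\<rbrakk>
      \<Longrightarrow> (f' \<cdot> f) \<star> (g' \<cdot> g) = (f' \<star> g') \<cdot> (f \<star> g)"
    and Unit_Ob: "Unit K \<in> Ob K"
    and Asc_Iso: "\<lbrakk>A \<in> Ob K; B \<in> Ob K; C \<in> Ob K\<rbrakk>
      \<Longrightarrow> Asc K A B C \<in> Iso K ((A \<boxtimes> B) \<boxtimes> C) (A \<boxtimes> (B \<boxtimes> C))"
    and Asc_natural: "\<lbrakk>f \<in> Hom K A A'; g \<in> Hom K B B'; h \<in> Hom K C C'\<rbrakk>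
      \<Longrightarrow> Asc K A' B' C' \<cdot> ((f \<star> g) \<star> h) = (f \<star> (g \<star> h)) \<cdot> Asc K A B C"
    and Lun_Iso: "A \<in> Ob K \<Longrightarrow> Lun K A \<in> Iso K (Unit K \<boxtimes> A) A"
    and Lun_natural: "f \<in> Hom K A B \<Longrightarrow> Lun K B \<cdot> (Idn K (Unit K) \<star> f) = f \<cdot> Lun K A"
    and Run_Iso: "A \<in> Ob K \<Longrightarrow> Run K A \<in> Iso K (A \<boxtimes> Unit K) A"
    and Run_natural: "f \<in> Hom K A B \<Longrightarrow> Run K B \<cdot> (f \<star> Idn K (Unit K)) = f \<cdot> Run K A"
    and pentagon: "\<lbrakk>A \<in> Ob K; B \<in> Ob K; C \<in> Ob K; D \<in> Ob K\<rbrakk>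
      \<Longrightarrow> Asc K A B (C \<boxtimes> D) \<cdot> Asc K (A \<boxtimes> B) C D =
          (Idn K A \<star> Asc K B C D) \<cdot> Asc K A (B \<boxtimes> C) D \<cdot> (Asc K A B C \<star> Idn K D)"
    and triangle_identity: "\<lbrakk>A \<in> Ob K; B \<in> Ob K\<rbrakk>
      \<Longrightarrow> (Idn K A \<star> Lun K B) \<cdot> Asc K A (Unit K) B = Run K A \<star> Idn K B"

definition tensor_left :: "('o, 'm, 'z) mtcat_scheme \<Rightarrow> 'o \<Rightarrow> ('o, 'm) efun" where
  "tensor_left K A = \<lparr>Fo = (\<lambda>B. A \<boxtimes>\<^bsub>K\<^esub> B), Fa = (\<lambda>f. Idn K A \<star>\<^bsub>K\<^esub> f)\<rparr>"

definition tensor_right :: "('o, 'm, 'z) mtcat_scheme \<Rightarrow> 'o \<Rightarrow> ('o, 'm) efun" where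
  "tensor_right K A = \<lparr>Fo = (\<lambda>B. B \<boxtimes>\<^bsub>K\<^esub> A), Fa = (\<lambda>f. f \<star>\<^bsub>K\<^esub> Idn K A)\<rparr>"

locale monoidal_triangulated_category = triangulated_category K + monoidal_category K
  for K :: "('o, 'm, 'z) mtcat_scheme" (structure) +
  assumes tensor_left_exact: "A \<in> Ob K \<Longrightarrow> \<exists>\<phi>. exact_functor K (tensor_left K A) \<phi>"
    and tensor_right_exact: "A \<in> Ob K \<Longrightarrow> \<exists>\<phi>. exact_functor K (tensor_right K A) \<phi>"

text \<open>The zigzag identities are stated on \<open>1 \<otimes> A\<close> and \<open>A' \<otimes> 1\<close> instead of \<open>A\<close> and \<open>A'\<close>,
  to avoid the inverses of the unit isomorphisms.\<close>

definition left_dual :: "('o, 'm, 'z) mtcat_scheme \<Rightarrow> 'o \<Rightarrow> 'o \<Rightarrow> bool" where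
  "left_dual K A A' \<longleftrightarrow> A \<in> Ob K \<and> A' \<in> Ob K \<and>
     (\<exists>ev\<in>Hom K (A' \<boxtimes>\<^bsub>K\<^esub> A) (Unit K). \<exists>coev\<in>Hom K (Unit K) (A \<boxtimes>\<^bsub>K\<^esub> A').
        Run K A \<cdot>\<^bsub>K\<^esub> (Idn K A \<star>\<^bsub>K\<^esub> ev) \<cdot>\<^bsub>K\<^esub> Asc K A A' A \<cdot>\<^bsub>K\<^esub> (coev \<star>\<^bsub>K\<^esub> Idn K A)
          = Lun K A \<and>
        Lun K A' \<cdot>\<^bsub>K\<^esub> (ev \<star>\<^bsub>K\<^esub> Idn K A') \<cdot>\<^bsub>K\<^esub> inv_ar K (Asc K A' A A')
            \<cdot>\<^bsub>K\<^esub> (Idn K A' \<star>\<^bsub>K\<^esub> coev)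
          = Run K A')"

definition right_dual :: "('o, 'm, 'z) mtcat_scheme \<Rightarrow> 'o \<Rightarrow> 'o \<Rightarrow> bool" where
  "right_dual K A A' \<longleftrightarrow> left_dual K A' A"

definition left_rigid :: "('o, 'm, 'z) mtcat_scheme \<Rightarrow> bool" where
  "left_rigid K \<longleftrightarrow> (\<forall>A\<in>Ob K. \<exists>A'. left_dual K A A')"

definition right_rigid :: "('o, 'm, 'z) mtcat_scheme \<Rightarrow> bool" where
  "right_rigid K \<longleftrightarrow> (\<forall>A\<in>Ob K. \<exists>A'. right_dual K A A')"


section \<open>Monoidal triangulated functors and group actions\<close>

text \<open>An endofunctor \<open>F\<close> with \<open>Ften F A B : F A \<otimes> F B \<rightarrow> F (A \<otimes> B)\<close>,
  \<open>Funit F : 1 \<rightarrow> F 1\<close> and \<open>Fsh F A : F (\<Sigma> A) \<rightarrow> \<Sigma> (F A)\<close>.\<close>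

record ('o, 'm) mtfun = "('o, 'm) efun" +
  Ften :: "'o \<Rightarrow> 'o \<Rightarrow> 'm"
  Funit :: "'m"
  Fsh :: "'o \<Rightarrow> 'm"

definition monoidal_functor ::
  "('o, 'm, 'z) mtcat_scheme \<Rightarrow> ('o, 'm, 'y) mtfun_scheme \<Rightarrow> bool" where
  "monoidal_functor K F \<longleftrightarrow> endofunctor K F \<and>
     (\<forall>A\<in>Ob K. \<forall>B\<in>Ob K. Ften F A B \<in> Iso K (Fo F A \<boxtimes>\<^bsub>K\<^esub> Fo F B) (Fo F (A \<boxtimes>\<^bsub>K\<^esub> B))) \<and>
     (\<forall>A A' B B'. \<forall>f\<in>Hom K A A'. \<forall>g\<in>Hom K B B'.
        Ften F A' B' \<cdot>\<^bsub>K\<^esub> (Fa F f \<star>\<^bsub>K\<^esub> Fa F g) = Fa F (f \<star>\<^bsub>K\<^esub> g) \<cdot>\<^bsub>K\<^esub> Ften F A B) \<and>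
     Funit F \<in> Iso K (Unit K) (Fo F (Unit K)) \<and>
     (\<forall>A\<in>Ob K. \<forall>B\<in>Ob K. \<forall>C\<in>Ob K.
        Ften F A (B \<boxtimes>\<^bsub>K\<^esub> C) \<cdot>\<^bsub>K\<^esub> (Idn K (Fo F A) \<star>\<^bsub>K\<^esub> Ften F B C)
            \<cdot>\<^bsub>K\<^esub> Asc K (Fo F A) (Fo F B) (Fo F C)
          = Fa F (Asc K A B C) \<cdot>\<^bsub>K\<^esub> Ften F (A \<boxtimes>\<^bsub>K\<^esub> B) C
            \<cdot>\<^bsub>K\<^esub> (Ften F A B \<star>\<^bsub>K\<^esub> Idn K (Fo F C))) \<and>
     (\<forall>A\<in>Ob K.
        Fa F (Lun K A) \<cdot>\<^bsub>K\<^esub> Ften F (Unit K) A \<cdot>\<^bsub>K\<^esub> (Funit F \<star>\<^bsub>K\<^esub> Idn K (Fo F A))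
          = Lun K (Fo F A) \<and>
        Fa F (Run K A) \<cdot>\<^bsub>K\<^esub> Ften F A (Unit K) \<cdot>\<^bsub>K\<^esub> (Idn K (Fo F A) \<star>\<^bsub>K\<^esub> Funit F)
          = Run K (Fo F A))"

definition mt_functor ::
  "('o, 'm, 'z) mtcat_scheme \<Rightarrow> ('o, 'm, 'y) mtfun_scheme \<Rightarrow> bool" where
  "mt_functor K F \<longleftrightarrow> monoidal_functor K F \<and> exact_functor K F (Fsh F)"

definition mt_autoequivalence ::
  "('o, 'm, 'z) mtcat_scheme \<Rightarrow> ('o, 'm, 'y) mtfun_scheme \<Rightarrow> bool" where
  "mt_autoequivalence K F \<longleftrightarrow> mt_functor K F \<and> autoequivalence K F"

definition mt_comp :: "('o, 'm, 'z) mtcat_scheme \<Rightarrow> ('o, 'm) mtfun \<Rightarrow> ('o, 'm) mtfun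
    \<Rightarrow> ('o, 'm) mtfun" where
  "mt_comp K F F' =
     \<lparr>Fo = (\<lambda>A. Fo F (Fo F' A)), Fa = (\<lambda>f. Fa F (Fa F' f)),
      Ften = (\<lambda>A B. Fa F (Ften F' A B) \<cdot>\<^bsub>K\<^esub> Ften F (Fo F' A) (Fo F' B)),
      Funit = Fa F (Funit F') \<cdot>\<^bsub>K\<^esub> Funit F,
      Fsh = (\<lambda>A. Fsh F (Fo F' A) \<cdot>\<^bsub>K\<^esub> Fa F (Fsh F' A))\<rparr>"

definition mt_nat_iso :: "('o, 'm, 'z) mtcat_scheme \<Rightarrow> ('o, 'm) mtfun \<Rightarrow> ('o, 'm) mtfun
    \<Rightarrow> ('o \<Rightarrow> 'm) \<Rightarrow> bool" where
  "mt_nat_iso K F F' \<eta> \<longleftrightarrow> nat_iso K F F' \<eta> \<and>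
     (\<forall>A\<in>Ob K. \<forall>B\<in>Ob K.
        \<eta> (A \<boxtimes>\<^bsub>K\<^esub> B) \<cdot>\<^bsub>K\<^esub> Ften F A B = Ften F' A B \<cdot>\<^bsub>K\<^esub> (\<eta> A \<star>\<^bsub>K\<^esub> \<eta> B)) \<and>
     \<eta> (Unit K) \<cdot>\<^bsub>K\<^esub> Funit F = Funit F' \<and>
     (\<forall>A\<in>Ob K. Fa (Sh K) (\<eta> A) \<cdot>\<^bsub>K\<^esub> Fsh F A = Fsh F' A \<cdot>\<^bsub>K\<^esub> \<eta> (Fo (Sh K) A))"

locale mt_group_action =
  fixes K :: "('o, 'm, 'z) mtcat_scheme"
    and G :: "('g, 'y) monoid_scheme"
    and T :: "'g \<Rightarrow> ('o, 'm) mtfun"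
    and \<gamma> :: "'g \<Rightarrow> 'g \<Rightarrow> 'o \<Rightarrow> 'm"
  assumes action_autoequivalence: "g \<in> carrier G \<Longrightarrow> mt_autoequivalence K (T g)"
    and action_nat_iso: "\<lbrakk>g \<in> carrier G; h \<in> carrier G\<rbrakk>
      \<Longrightarrow> mt_nat_iso K (mt_comp K (T g) (T h)) (T (g \<otimes>\<^bsub>G\<^esub> h)) (\<gamma> g h)"
    and action_cocycle:
      "\<lbrakk>g \<in> carrier G; h \<in> carrier G; k \<in> carrier G; A \<in> Ob K\<rbrakk>
      \<Longrightarrow> \<gamma> g (h \<otimes>\<^bsub>G\<^esub> k) A \<cdot>\<^bsub>K\<^esub> Fa (T g) (\<gamma> h k A)
          = \<gamma> (g \<otimes>\<^bsub>G\<^esub> h) k A \<cdot>\<^bsub>K\<^esub> \<gamma> g h (Fo (T k) A)"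


section \<open>Thick ideals and the spectrum\<close>

definition triangulated_subcategory :: "('o, 'm, 'z) tricat_scheme \<Rightarrow> 'o set \<Rightarrow> bool" where
  "triangulated_subcategory K I \<longleftrightarrow> I \<subseteq> Ob K \<and>
     (\<forall>A B. A \<in> I \<and> isomorphic K A B \<longrightarrow> B \<in> I) \<and>
     (\<forall>Z. zero_object K Z \<longrightarrow> Z \<in> I) \<and>
     (\<forall>A\<in>Ob K. A \<in> I \<longleftrightarrow> Fo (Sh K) A \<in> I) \<and>
     (\<forall>A B C f g h. dtriangle K A B C f g h \<and> A \<in> I \<and> B \<in> I \<longrightarrow> C \<in> I)"

definition thick_ideal :: "('o, 'm, 'z) mtcat_scheme \<Rightarrow> 'o set \<Rightarrow> bool" where
  "thick_ideal K I \<longleftrightarrow> triangulated_subcategory K I \<and>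
     (\<forall>A B E i j p q. biproduct K A B E i j p q \<and> E \<in> I \<longrightarrow> A \<in> I \<and> B \<in> I) \<and>
     (\<forall>A\<in>I. \<forall>B\<in>Ob K. A \<boxtimes>\<^bsub>K\<^esub> B \<in> I \<and> B \<boxtimes>\<^bsub>K\<^esub> A \<in> I)"

definition tensor_set :: "('o, 'm, 'z) mtcat_scheme \<Rightarrow> 'o set \<Rightarrow> 'o set \<Rightarrow> 'o set" where
  "tensor_set K I J = {A \<boxtimes>\<^bsub>K\<^esub> B | A B. A \<in> I \<and> B \<in> J}"

definition prime_ideal :: "('o, 'm, 'z) mtcat_scheme \<Rightarrow> 'o set \<Rightarrow> bool" where
  "prime_ideal K P \<longleftrightarrow> thick_ideal K P \<and> P \<noteq> Ob K \<and>
     (\<forall>I J. thick_ideal K I \<and> thick_ideal K J \<and> tensor_set K I J \<subseteq> P \<longrightarrow> I \<subseteq> P \<or> J \<subseteq> P)"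

definition Spc :: "('o, 'm, 'z) mtcat_scheme \<Rightarrow> 'o set set" where
  "Spc K = {P. prime_ideal K P}"

definition Vset :: "('o, 'm, 'z) mtcat_scheme \<Rightarrow> 'o set \<Rightarrow> 'o set set" where
  "Vset K S = {P \<in> Spc K. S \<inter> P = {}}"

definition Spc_topology :: "('o, 'm, 'z) mtcat_scheme \<Rightarrow> 'o set topology" where
  "Spc_topology K = topology (\<lambda>U. \<exists>S \<subseteq> Ob K. U = Spc K - Vset K S)"

definition noetherian_space :: "'a topology \<Rightarrow> bool" where
  "noetherian_space X \<longleftrightarrow>
     (\<forall>C :: nat \<Rightarrow> 'a set. (\<forall>n. closedin X (C n)) \<and> decseq C \<longrightarrow> (\<exists>N. \<forall>n\<ge>N. C n = C N))"

text \<open>The sets \<open>Vset K S\<close> are the closed sets of a topology.\<close>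

context category
begin

lemma Hom_Ob: "f \<in> Hom K A B \<Longrightarrow> A \<in> Ob K \<and> B \<in> Ob K"
  using Dom_Ob Cod_Ob by (auto simp: Hom_def)

lemma Iso_witness:
  assumes "f \<in> Hom K A B" "g \<in> Hom K B A" "g \<cdot> f = Idn K A" "f \<cdot> g = Idn K B"
  shows "f \<in> Iso K A B"
  using assms unfolding Iso_def inverse_ar_def Hom_def by auto

end

context additive_category
begin

lemma hom_group_group: "\<lbrakk>A \<in> Ob K; B \<in> Ob K\<rbrakk> \<Longrightarrow> group (hom_group K A B)"
  using hom_comm_group by (simp add: comm_group_def)

lemma Hom_group: "f \<in> Hom K A B \<Longrightarrow> group (hom_group K A B)"
  using hom_group_group Hom_Ob by blast

lemma hom_group_monoid: "\<lbrakk>A \<in> Ob K; B \<in> Ob K\<rbrakk> \<Longrightarrow> monoid (hom_group K A B)"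
  using hom_group_group by (simp add: group.is_monoid)

lemma Hom_monoid: "f \<in> Hom K A B \<Longrightarrow> monoid (hom_group K A B)"
  using Hom_group by (simp add: group.is_monoid)

lemma Zero_Hom: "\<lbrakk>A \<in> Ob K; B \<in> Ob K\<rbrakk> \<Longrightarrow> Zero K A B \<in> Hom K A B"
  using monoid.one_closed[OF hom_group_monoid] by (simp add: hom_group_def)

lemma Add_Hom: "\<lbrakk>f \<in> Hom K A B; g \<in> Hom K A B\<rbrakk> \<Longrightarrow> f \<boxplus> g \<in> Hom K A B"
  using monoid.m_closed[OF Hom_monoid, of f A B f g] by (simp add: hom_group_def)

lemma Add_Zero: "f \<in> Hom K A B \<Longrightarrow> f \<boxplus> Zero K A B = f"
  using monoid.r_one[OF Hom_monoid, of f A B f] by (simp add: hom_group_def)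

lemma Zero_Add: "f \<in> Hom K A B \<Longrightarrow> Zero K A B \<boxplus> f = f"
  using monoid.l_one[OF Hom_monoid, of f A B f] by (simp add: hom_group_def)

lemma Add_cancel:
  "\<lbrakk>f \<in> Hom K A B; f' \<in> Hom K A B; g \<in> Hom K A B; f \<boxplus> g = f' \<boxplus> g\<rbrakk> \<Longrightarrow> f = f'"
  using group.right_cancel[OF Hom_group, of f A B g f f'] by (simp add: hom_group_def)

lemma Add_idem: "f \<in> Hom K A B \<Longrightarrow> f \<boxplus> f = f \<Longrightarrow> f = Zero K A B"
  using Add_cancel[of f A B "Zero K A B" f] Zero_Add[of f A B] Zero_Hom[of A B] Hom_Ob[of f A B]
  by simp

lemma Neg_Hom: "f \<in> Hom K A B \<Longrightarrow> Neg K f \<in> Hom K A B"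
  using group.inv_closed[OF Hom_group, of f A B f] by (simp add: Neg_def Hom_def hom_group_def)

lemma Neg_right: "f \<in> Hom K A B \<Longrightarrow> f \<boxplus> Neg K f = Zero K A B"
  using group.r_inv[OF Hom_group, of f A B f] by (simp add: Neg_def Hom_def hom_group_def)

lemma Zero_Cmp: assumes "f \<in> Hom K A B" "C \<in> Ob K" shows "Zero K B C \<cdot> f = Zero K A C"
proof (rule Add_idem)
  have z: "Zero K B C \<in> Hom K B C" using Zero_Hom Hom_Ob assms by blast
  show "Zero K B C \<cdot> f \<in> Hom K A C" using Cmp_Hom assms z by blast
  show "(Zero K B C \<cdot> f) \<boxplus> (Zero K B C \<cdot> f) = Zero K B C \<cdot> f"
    using Cmp_Add_right[OF assms(1) z z] Add_Zero[OF z] by simp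
qed

lemma Cmp_Zero: assumes "f \<in> Hom K A B" "C \<in> Ob K" shows "f \<cdot> Zero K C A = Zero K C B"
proof (rule Add_idem)
  have z: "Zero K C A \<in> Hom K C A" using Zero_Hom Hom_Ob assms by blast
  show "f \<cdot> Zero K C A \<in> Hom K C B" using Cmp_Hom assms z by blast
  show "(f \<cdot> Zero K C A) \<boxplus> (f \<cdot> Zero K C A) = f \<cdot> Zero K C A"
    using Cmp_Add_left[OF z z assms(1)] Add_Zero[OF z] by simp
qed

lemma zero_objectI: assumes Z: "Z \<in> Ob K" and id0: "Idn K Z = Zero K Z Z" shows "zero_object K Z"
  unfolding zero_object_def
proof (intro conjI ballI)
  fix A assume A: "A \<in> Ob K"
  have "f = Zero K Z A" if "f \<in> Hom K Z A" for f
    using Idn_right[OF that] Cmp_Zero[OF that Z] id0 by simp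
  then show "\<exists>!f. f \<in> Hom K Z A" using Zero_Hom[OF Z A] by blast
  have "f = Zero K A Z" if "f \<in> Hom K A Z" for f
    using Idn_left[OF that] Zero_Cmp[OF that Z] id0 by simp
  then show "\<exists>!f. f \<in> Hom K A Z" using Zero_Hom[OF A Z] by blast
qed (rule Z)

lemma zero_object_from: "\<lbrakk>zero_object K Z; f \<in> Hom K Z A\<rbrakk> \<Longrightarrow> f = Zero K Z A"
  using Zero_Hom Hom_Ob unfolding zero_object_def by blast

end

context triangulated_category
begin

lemma shift_Ob: "A \<in> Ob K \<Longrightarrow> Fo (Sh K) A \<in> Ob K"
  and shift_Hom: "f \<in> Hom K A B \<Longrightarrow> Fa (Sh K) f \<in> Hom K (Fo (Sh K) A) (Fo (Sh K) B)"
  and shift_Idn: "A \<in> Ob K \<Longrightarrow> Fa (Sh K) (Idn K A) = Idn K (Fo (Sh K) A)"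
  and shift_Cmp: "\<lbrakk>f \<in> Hom K A B; g \<in> Hom K B C\<rbrakk>
    \<Longrightarrow> Fa (Sh K) (g \<cdot> f) = Fa (Sh K) g \<cdot> Fa (Sh K) f"
  and shift_Add: "\<lbrakk>f \<in> Hom K A B; g \<in> Hom K A B\<rbrakk>
    \<Longrightarrow> Fa (Sh K) (f \<boxplus> g) = Fa (Sh K) f \<boxplus> Fa (Sh K) g"
  using shift_additive unfolding additive_functor_def endofunctor_def by blast+

lemma shift_Zero: assumes "A \<in> Ob K" "B \<in> Ob K"
  shows "Fa (Sh K) (Zero K A B) = Zero K (Fo (Sh K) A) (Fo (Sh K) B)"
  by (rule Add_idem) (use Zero_Hom[OF assms] shift_Hom shift_Add Add_Zero in metis)+

lemma shift_zero_object: assumes "zero_object K Z" shows "zero_object K (Fo (Sh K) Z)"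
proof (rule zero_objectI)
  have Z: "Z \<in> Ob K" using assms by (simp add: zero_object_def)
  show "Fo (Sh K) Z \<in> Ob K" using shift_Ob[OF Z] .
  have "Idn K Z = Zero K Z Z" using zero_object_from[OF assms Idn_Hom[OF Z]] .
  then show "Idn K (Fo (Sh K) Z) = Zero K (Fo (Sh K) Z) (Fo (Sh K) Z)"
    using shift_Idn[OF Z] shift_Zero[OF Z Z] by simp
qed

lemma dtriangle_Cmp: assumes "dtriangle K A B C f g h" shows "g \<cdot> f = Zero K A C"
proof -
  have fg: "f \<in> Hom K A B" "g \<in> Hom K B C"
    using assms by (auto simp: dtriangle_def triangle_def)
  have A: "A \<in> Ob K" using Hom_Ob[OF fg(1)] by simp
  obtain Z where Z: "zero_object K Z" using ex_zero_object by blast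
  have ZO: "Z \<in> Ob K" using Z by (simp add: zero_object_def)
  obtain c where c: "c \<in> Hom K Z C" "c \<cdot> Zero K A Z = g \<cdot> f"
    using TR3[OF TR1_id[OF A Z] assms Idn_Hom[OF A] fg(1)] by blast
  then show ?thesis using Cmp_Zero[OF c(1) A] by simp
qed

lemma dtriangle_weak_cokernel:
  assumes "dtriangle K A B C f g h" "u \<in> Hom K B X" "u \<cdot> f = Zero K A X"
  shows "\<exists>c\<in>Hom K C X. c \<cdot> g = u"
proof -
  have f: "f \<in> Hom K A B" using assms by (auto simp: dtriangle_def triangle_def)
  have A: "A \<in> Ob K" and X: "X \<in> Ob K" using Hom_Ob f assms(2) by blast+
  obtain Z where Z: "zero_object K Z" using ex_zero_object by blast
  have ZO: "Z \<in> Ob K" using Z by (simp add: zero_object_def)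
  let ?h = "Zero K X (Fo (Sh K) Z)"
  have "triangle K Z X X (Zero K Z X) (Idn K X) ?h"
    unfolding triangle_def using Zero_Hom Idn_Hom shift_Ob ZO X by blast
  moreover have "Neg K (Fa (Sh K) (Zero K Z X)) = Zero K (Fo (Sh K) Z) (Fo (Sh K) X)"
    using zero_object_from[OF shift_zero_object[OF Z] Neg_Hom[OF shift_Hom[OF Zero_Hom[OF ZO X]]]] .
  ultimately have d: "dtriangle K Z X X (Zero K Z X) (Idn K X) ?h"
    using TR2 TR1_id[OF X shift_zero_object[OF Z]] by simp
  have "u \<cdot> f = Zero K Z X \<cdot> Zero K A Z"
    using assms(3) Zero_Cmp[OF Zero_Hom[OF A ZO] X] by simp
  from TR3[OF assms(1) d Zero_Hom[OF A ZO] assms(2) this] Idn_left[OF assms(2)]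
  show ?thesis by auto
qed

lemma triangulated_subcategory_middle:
  assumes S: "triangulated_subcategory K S" and d: "dtriangle K A B C f g h"
    and "A \<in> S" "C \<in> S"
  shows "B \<in> S"
proof -
  have t: "f \<in> Hom K A B" "g \<in> Hom K B C" "h \<in> Hom K C (Fo (Sh K) A)"
    using d by (auto simp: dtriangle_def triangle_def)
  have d1: "dtriangle K B C (Fo (Sh K) A) g h (Neg K (Fa (Sh K) f))"
    using d TR2 by (auto simp: dtriangle_def)
  have d2: "dtriangle K C (Fo (Sh K) A) (Fo (Sh K) B) h (Neg K (Fa (Sh K) f))
      (Neg K (Fa (Sh K) g))"
    using d1 TR2 by (auto simp: dtriangle_def)
  have "Fo (Sh K) A \<in> S" using S \<open>A \<in> S\<close> unfolding triangulated_subcategory_def by blast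
  then have "Fo (Sh K) B \<in> S"
    using S d2 \<open>C \<in> S\<close> unfolding triangulated_subcategory_def by blast
  moreover have "B \<in> Ob K" using Hom_Ob[OF t(1)] by simp
  ultimately show ?thesis using S unfolding triangulated_subcategory_def by blast
qed

lemma triangulated_subcategory_biproduct:
  assumes S: "triangulated_subcategory K S" and b: "biproduct K A B E i j p q"
    and AB: "A \<in> S" "B \<in> S"
  shows "E \<in> S"
proof -
  have m: "i \<in> Hom K A E" "j \<in> Hom K B E" "p \<in> Hom K E A" "q \<in> Hom K E B"
    and e: "p \<cdot> i = Idn K A" "q \<cdot> j = Idn K B" "q \<cdot> i = Zero K A B" "p \<cdot> j = Zero K B A"
      "(i \<cdot> p) \<boxplus> (j \<cdot> q) = Idn K E"
    using b by (auto simp: biproduct_def)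
  have O: "A \<in> Ob K" "B \<in> Ob K" "E \<in> Ob K" using Hom_Ob m by blast+
  obtain C r t where d: "dtriangle K A E C i r t" using TR1_cone[OF m(1)] by blast
  have rt: "r \<in> Hom K E C" "t \<in> Hom K C (Fo (Sh K) A)"
    using d by (auto simp: dtriangle_def triangle_def)
  have C: "C \<in> Ob K" using Hom_Ob[OF rt(1)] by simp
  have d1: "dtriangle K E C (Fo (Sh K) A) r t (Neg K (Fa (Sh K) i))"
    using d TR2 by (auto simp: dtriangle_def)
  have d2: "dtriangle K C (Fo (Sh K) A) (Fo (Sh K) E) t (Neg K (Fa (Sh K) i))
      (Neg K (Fa (Sh K) r))"
    using d1 TR2 by (auto simp: dtriangle_def)
  have si: "Fa (Sh K) i \<in> Hom K (Fo (Sh K) A) (Fo (Sh K) E)" using shift_Hom[OF m(1)] .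
  have sp: "Fa (Sh K) p \<in> Hom K (Fo (Sh K) E) (Fo (Sh K) A)" using shift_Hom[OF m(3)] .
  have n0: "Neg K (Fa (Sh K) i) \<cdot> t = Zero K C (Fo (Sh K) E)" using dtriangle_Cmp[OF d2] .
  have it: "Fa (Sh K) i \<cdot> t \<in> Hom K C (Fo (Sh K) E)" using Cmp_Hom[OF rt(2) si] .
  have "Fa (Sh K) i \<cdot> t = (Fa (Sh K) i \<cdot> t) \<boxplus> (Neg K (Fa (Sh K) i) \<cdot> t)"
    using n0 Add_Zero[OF it] by simp
  also have "\<dots> = (Fa (Sh K) i \<boxplus> Neg K (Fa (Sh K) i)) \<cdot> t"
    using Cmp_Add_right[OF rt(2) si Neg_Hom[OF si]] by simp
  also have "\<dots> = Zero K C (Fo (Sh K) E)"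
    using Neg_right[OF si] Zero_Cmp[OF rt(2) shift_Ob[OF O(3)]] by simp
  finally have i0: "Fa (Sh K) i \<cdot> t = Zero K C (Fo (Sh K) E)" .
  have "t = Idn K (Fo (Sh K) A) \<cdot> t" using Idn_left[OF rt(2)] by simp
  also have "\<dots> = (Fa (Sh K) p \<cdot> Fa (Sh K) i) \<cdot> t"
    using shift_Cmp[OF m(1) m(3)] e(1) shift_Idn[OF O(1)] by simp
  also have "\<dots> = Fa (Sh K) p \<cdot> (Fa (Sh K) i \<cdot> t)" using Cmp_assoc[OF rt(2) si sp] .
  finally have t0: "t = Zero K C (Fo (Sh K) A)" using i0 Cmp_Zero[OF sp C] by simp
  obtain s where s: "s \<in> Hom K C B" "s \<cdot> r = q"
    using dtriangle_weak_cokernel[OF d m(4) e(3)] by blast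
  let ?u = "r \<cdot> j"
  have u: "?u \<in> Hom K B C" using Cmp_Hom[OF m(2) rt(1)] .
  have su: "s \<cdot> ?u = Idn K B" using Cmp_assoc[OF m(2) rt(1) s(1)] s(2) e(2) by simp
  have us: "?u \<cdot> s \<in> Hom K C C" using Cmp_Hom[OF s(1) u] .
  have ri: "r \<cdot> i = Zero K A C" using dtriangle_Cmp[OF d] .
  have ip: "i \<cdot> p \<in> Hom K E E" and jq: "j \<cdot> q \<in> Hom K E E" using Cmp_Hom m by blast+
  have rip: "r \<cdot> (i \<cdot> p) = Zero K E C"
    using Cmp_assoc[OF m(3) m(1) rt(1)] ri Zero_Cmp[OF m(3) C] by simp
  have rjq: "r \<cdot> (j \<cdot> q) \<in> Hom K E C" using Cmp_Hom[OF jq rt(1)] .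
  have "r = r \<cdot> ((i \<cdot> p) \<boxplus> (j \<cdot> q))" using e(5) Idn_right[OF rt(1)] by simp
  also have "\<dots> = r \<cdot> (j \<cdot> q)" using Cmp_Add_left[OF ip jq rt(1)] rip Zero_Add[OF rjq] by simp
  also have "\<dots> = ?u \<cdot> q" using Cmp_assoc[OF m(4) m(2) rt(1)] by simp
  also have "\<dots> = (?u \<cdot> s) \<cdot> r" using Cmp_assoc[OF rt(1) s(1) u] s(2) by simp
  finally have usr: "(?u \<cdot> s) \<cdot> r = r" by simp
  have nus: "Neg K (?u \<cdot> s) \<in> Hom K C C" using Neg_Hom[OF us] .
  let ?w = "Idn K C \<boxplus> Neg K (?u \<cdot> s)"
  have w: "?w \<in> Hom K C C" using Add_Hom[OF Idn_Hom[OF C] nus] .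
  have "?w \<cdot> r = (Idn K C \<cdot> r) \<boxplus> (Neg K (?u \<cdot> s) \<cdot> r)"
    using Cmp_Add_right[OF rt(1) Idn_Hom[OF C] nus] .
  also have "\<dots> = ((?u \<cdot> s) \<cdot> r) \<boxplus> (Neg K (?u \<cdot> s) \<cdot> r)"
    using usr Idn_left[OF rt(1)] by simp
  also have "\<dots> = ((?u \<cdot> s) \<boxplus> Neg K (?u \<cdot> s)) \<cdot> r"
    using Cmp_Add_right[OF rt(1) us nus] by simp
  also have "\<dots> = Zero K E C" using Neg_right[OF us] Zero_Cmp[OF rt(1) C] by simp
  finally have "?w \<cdot> r = Zero K E C" .
  then obtain c where c: "c \<in> Hom K (Fo (Sh K) A) C" "c \<cdot> t = ?w"
    using dtriangle_weak_cokernel[OF d1 w] by blast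
  then have w0: "?w = Zero K C C" using t0 Cmp_Zero[OF c(1) C] by simp
  have "Idn K C = ?u \<cdot> s"
    using Add_cancel[OF Idn_Hom[OF C] us nus] w0 Neg_right[OF us] by simp
  then have "?u \<in> Iso K B C" using Iso_witness[OF u s(1) su] by simp
  then have "C \<in> S"
    using S AB(2) unfolding triangulated_subcategory_def isomorphic_def by blast
  then show ?thesis using triangulated_subcategory_middle[OF S d AB(1)] by blast
qed

end

lemma (in monoidal_triangulated_category) istopology_Spc:
  "istopology (\<lambda>U. \<exists>S \<subseteq> Ob K. U = Spc K - Vset K S)"
  unfolding istopology_def
proof (intro conjI allI impI)
  fix U U' assume "\<exists>S\<subseteq>Ob K. U = Spc K - Vset K S" "\<exists>S\<subseteq>Ob K. U' = Spc K - Vset K S"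
  then obtain S S' where S: "S \<subseteq> Ob K" "U = Spc K - Vset K S"
    and S': "S' \<subseteq> Ob K" "U' = Spc K - Vset K S'" by blast
  let ?R = "{E. \<exists>A\<in>S. \<exists>B\<in>S'. \<exists>i j p q. biproduct K A B E i j p q}"
  have R: "?R \<subseteq> Ob K" using Hom_Ob by (auto simp: biproduct_def)
  have sum: "E \<in> P \<longleftrightarrow> A \<in> P \<and> B \<in> P"
    if P: "P \<in> Spc K" and b: "biproduct K A B E i j p q" for P A B E i j p q
  proof
    have "thick_ideal K P" using P by (simp add: Spc_def prime_ideal_def)
    then have "\<forall>A B E i j p q. biproduct K A B E i j p q \<and> E \<in> P \<longrightarrow> A \<in> P \<and> B \<in> P"
      unfolding thick_ideal_def by (elim conjE)
    then show "A \<in> P \<and> B \<in> P" if "E \<in> P" using b that by metis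
  next
    have "thick_ideal K P" using P by (simp add: Spc_def prime_ideal_def)
    then have "triangulated_subcategory K P" unfolding thick_ideal_def by (elim conjE)
    then show "E \<in> P" if "A \<in> P \<and> B \<in> P"
      using triangulated_subcategory_biproduct[OF _ b] that by simp
  qed
  have ex: "\<exists>E. \<exists>i j p q. biproduct K A B E i j p q" if "A \<in> S" "B \<in> S'" for A B
    using ex_biproduct[of A B] S(1) S'(1) that by fast
  have R_iff: "?R \<inter> P = {} \<longleftrightarrow> S \<inter> P = {} \<or> S' \<inter> P = {}" if P: "P \<in> Spc K" for P
  proof
    assume R0: "?R \<inter> P = {}"
    show "S \<inter> P = {} \<or> S' \<inter> P = {}"
    proof (rule ccontr)
      assume "\<not> ?thesis"
      then obtain A B where AB: "A \<in> S" "A \<in> P" "B \<in> S'" "B \<in> P" by auto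
      obtain E i j p q where b: "biproduct K A B E i j p q" using ex[OF AB(1,3)] by (elim exE)
      have "E \<in> P" using sum[OF P b] AB by simp
      moreover have "E \<in> ?R" using AB b by fast
      ultimately show False using R0 by (simp add: disjoint_iff)
    qed
  next
    assume *: "S \<inter> P = {} \<or> S' \<inter> P = {}"
    show "?R \<inter> P = {}"
    proof (rule equals0I)
      fix E assume "E \<in> ?R \<inter> P"
      then have E: "E \<in> ?R" "E \<in> P" by (rule IntD1 IntD2)+
      obtain A B i j p q where "A \<in> S" "B \<in> S'" "biproduct K A B E i j p q"
        using E(1) by fast
      moreover from this have "A \<in> P" "B \<in> P" using sum[OF P, of A B E i j p q] E(2) by simp_all
      ultimately show False using * by fast
    qed
  qed
  have "U \<inter> U' = Spc K - Vset K ?R"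
  proof (rule Set.set_eqI)
    fix P
    have mem: "P \<in> Spc K - Vset K X \<longleftrightarrow> P \<in> Spc K \<and> X \<inter> P \<noteq> {}" for X
      unfolding Vset_def by blast
    show "P \<in> U \<inter> U' \<longleftrightarrow> P \<in> Spc K - Vset K ?R"
    proof (cases "P \<in> Spc K")
      case True
      then show ?thesis unfolding S(2) S'(2) Int_iff mem R_iff[OF True]
        by (simp only: de_Morgan_disj simp_thms)
    next
      case False
      then show ?thesis unfolding S(2) S'(2) Int_iff mem by (simp only: simp_thms)
    qed
  qed
  then show "\<exists>S\<subseteq>Ob K. U \<inter> U' = Spc K - Vset K S"
    using R by (intro exI conjI)
next
  fix \<U> assume *: "\<forall>U\<in>\<U>. \<exists>S\<subseteq>Ob K. U = Spc K - Vset K S"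
  obtain S where S: "\<forall>U\<in>\<U>. S U \<subseteq> Ob K \<and> U = Spc K - Vset K (S U)"
    using bchoice[OF *] by (elim exE)
  have "\<Union>\<U> = (\<Union>U\<in>\<U>. Spc K - Vset K (S U))" using S by blast
  also have "\<dots> = Spc K - Vset K (\<Union>U\<in>\<U>. S U)" unfolding Vset_def by blast
  finally have eq: "\<Union>\<U> = Spc K - Vset K (\<Union>U\<in>\<U>. S U)" .
  have "(\<Union>U\<in>\<U>. S U) \<subseteq> Ob K" using S by (simp add: UN_subset_iff)
  then show "\<exists>S\<subseteq>Ob K. \<Union>\<U> = Spc K - Vset K S" using eq by (intro exI conjI)
qed

lemma (in monoidal_triangulated_category) closedin_Spc_topology:
  "closedin (Spc_topology K) C \<longleftrightarrow> (\<exists>S \<subseteq> Ob K. C = Vset K S)"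
proof -
  have o: "openin (Spc_topology K) U \<longleftrightarrow> (\<exists>S \<subseteq> Ob K. U = Spc K - Vset K S)" for U
    using istopology_Spc by (simp add: Spc_topology_def)
  have V: "Vset K S \<subseteq> Spc K" for S by (auto simp: Vset_def)
  obtain Z where Z: "zero_object K Z" using ex_zero_object by (rule exE)
  then have "Z \<in> Ob K" by (simp add: zero_object_def)
  moreover have "Z \<in> P" if "P \<in> Spc K" for P
  proof -
    have "triangulated_subcategory K P"
      using that by (simp add: Spc_def prime_ideal_def thick_ideal_def)
    then show ?thesis using Z unfolding triangulated_subcategory_def by metis
  qed
  ultimately have "Vset K (Ob K) = {}" unfolding Vset_def by auto
  then have "openin (Spc_topology K) (Spc K)" unfolding o by (intro exI[of _ "Ob K"]) simp
  moreover have "U \<subseteq> Spc K" if "openin (Spc_topology K) U" for U using that o by auto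
  ultimately have top: "topspace (Spc_topology K) = Spc K" unfolding topspace_def by blast
  show ?thesis
  proof
    assume "closedin (Spc_topology K) C"
    then obtain S where "C \<subseteq> Spc K" "S \<subseteq> Ob K" "Spc K - C = Spc K - Vset K S"
      unfolding closedin_def top o by auto
    then show "\<exists>S \<subseteq> Ob K. C = Vset K S" using V[of S] by (intro exI[of _ S]) auto
  next
    assume "\<exists>S \<subseteq> Ob K. C = Vset K S"
    then show "closedin (Spc_topology K) C" unfolding closedin_def top o using V by auto
  qed
qed


section \<open>The equivariant spectrum\<close>

definition translate ::
  "('o, 'm, 'z) mtcat_scheme \<Rightarrow> ('g \<Rightarrow> ('o, 'm) mtfun) \<Rightarrow> 'g \<Rightarrow> 'o set \<Rightarrow> 'o set" where
  "translate K T g I = {B. \<exists>A\<in>I. isomorphic K (Fo (T g) A) B}"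

definition G_ideal :: "('o, 'm, 'z) mtcat_scheme \<Rightarrow> ('g, 'y) monoid_scheme
    \<Rightarrow> ('g \<Rightarrow> ('o, 'm) mtfun) \<Rightarrow> 'o set \<Rightarrow> bool" where
  "G_ideal K G T I \<longleftrightarrow> thick_ideal K I \<and> (\<forall>g\<in>carrier G. translate K T g I \<subseteq> I)"

definition G_prime :: "('o, 'm, 'z) mtcat_scheme \<Rightarrow> ('g, 'y) monoid_scheme
    \<Rightarrow> ('g \<Rightarrow> ('o, 'm) mtfun) \<Rightarrow> 'o set \<Rightarrow> bool" where
  "G_prime K G T Q \<longleftrightarrow> G_ideal K G T Q \<and> Q \<noteq> Ob K \<and>
     (\<forall>I J. G_ideal K G T I \<and> G_ideal K G T J \<and> tensor_set K I J \<subseteq> Q \<longrightarrow> I \<subseteq> Q \<or> J \<subseteq> Q)"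

definition G_Spc :: "('o, 'm, 'z) mtcat_scheme \<Rightarrow> ('g, 'y) monoid_scheme
    \<Rightarrow> ('g \<Rightarrow> ('o, 'm) mtfun) \<Rightarrow> 'o set set" where
  "G_Spc K G T = {Q. G_prime K G T Q}"

definition G_core :: "('o, 'm, 'z) mtcat_scheme \<Rightarrow> ('g, 'y) monoid_scheme
    \<Rightarrow> ('g \<Rightarrow> ('o, 'm) mtfun) \<Rightarrow> 'o set \<Rightarrow> 'o set" where
  "G_core K G T I = (\<Inter>g\<in>carrier G. translate K T g I)"

text \<open>The map on orbits induced by \<^const>\<open>G_core\<close>, which is constant on each orbit.\<close>

definition c2 :: "('o, 'm, 'z) mtcat_scheme \<Rightarrow> ('g, 'y) monoid_scheme
    \<Rightarrow> ('g \<Rightarrow> ('o, 'm) mtfun) \<Rightarrow> 'o set set \<Rightarrow> 'o set" where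
  "c2 K G T X = the_elem (G_core K G T ` X)"

end

theory Submission
  imports Defs
begin

text \<open>
  In the topology of \<open>Spc K\<close> the closure of a point \<open>P\<close> is the set of primes contained in \<open>P\<close>. If
  the spectrum is Noetherian, this closure is the support of a single object \<open>B\<close>, so that a prime
  \<open>Q\<close> misses \<open>B\<close> exactly when \<open>Q \<subseteq> P\<close> (\<open>noetherian_ex_point_support\<close>). Such an object replaces
  the finiteness of \<open>G\<close> in the classical argument about primes over an invariant prime.

  Injectivity: let \<open>(P : G) = (Q : G)\<close>. The object attached to \<open>P\<close> is not in \<open>(Q : G)\<close>, the
  intersection of all \<open>T\<^sub>g Q\<close>, so it is missed by some \<open>T\<^sub>g Q\<close>, that is, \<open>T\<^sub>g Q \<subseteq> P\<close>. By symmetry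
  \<open>T\<^sub>h P \<subseteq> Q\<close> for some \<open>h\<close>, so \<open>T\<^sub>h\<^sub>g Q \<subseteq> T\<^sub>h P \<subseteq> Q\<close>. The iterates of \<open>T\<^sub>h\<^sub>g\<close> on \<open>Q\<close> give a
  descending chain of primes, which is stationary; hence \<open>T\<^sub>h\<^sub>g Q = Q\<close> and \<open>T\<^sub>h P = Q\<close>.

  Surjectivity: rigidity makes every thick ideal the intersection of the primes containing it
  (\<open>rigid_ex_prime\<close>), because \<open>A\<close> is a direct summand of \<open>A \<otimes> A' \<otimes> A\<close> for a dual \<open>A'\<close> of \<open>A\<close>. For
  a \<open>G\<close>-prime \<open>Q\<close>, a prime \<open>P\<close> minimal over \<open>Q\<close> exists by the descending chain condition, and
  \<open>G\<close>-primality forces \<open>(P : G) = Q\<close> (\<open>noetherian_G_prime_core\<close>).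
\<close>

section \<open>Isomorphic objects and functors\<close>

context category
begin

lemma IsoE:
  assumes "f \<in> Iso K A B"
  obtains g where "f \<in> Hom K A B" "g \<in> Hom K B A" "g \<cdot> f = Idn K A" "f \<cdot> g = Idn K B"
  using assms unfolding Iso_def inverse_ar_def Hom_def by auto

lemma isomorphic_Ob: "isomorphic K A B \<Longrightarrow> A \<in> Ob K \<and> B \<in> Ob K"
  unfolding isomorphic_def Iso_def using Hom_Ob by blast

lemma isomorphic_refl: "A \<in> Ob K \<Longrightarrow> isomorphic K A A"
  using Iso_witness[OF Idn_Hom Idn_Hom] Idn_left[OF Idn_Hom] unfolding isomorphic_def by blast

lemma isomorphic_sym: assumes "isomorphic K A B" shows "isomorphic K B A"
proof -
  obtain f where "f \<in> Iso K A B" using assms unfolding isomorphic_def by blast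
  then obtain g where "f \<in> Hom K A B" "g \<in> Hom K B A" "g \<cdot> f = Idn K A" "f \<cdot> g = Idn K B"
    by (rule IsoE)
  then show ?thesis using Iso_witness[of g B A f] unfolding isomorphic_def by blast
qed

lemma isomorphic_trans:
  assumes "isomorphic K A B" "isomorphic K B C" shows "isomorphic K A C"
proof -
  obtain f where "f \<in> Iso K A B" using assms(1) unfolding isomorphic_def by blast
  then obtain f' where f: "f \<in> Hom K A B" "f' \<in> Hom K B A" "f' \<cdot> f = Idn K A" "f \<cdot> f' = Idn K B"
    by (rule IsoE)
  obtain g where "g \<in> Iso K B C" using assms(2) unfolding isomorphic_def by blast
  then obtain g' where g: "g \<in> Hom K B C" "g' \<in> Hom K C B" "g' \<cdot> g = Idn K B" "g \<cdot> g' = Idn K C"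
    by (rule IsoE)
  have "(f' \<cdot> g') \<cdot> (g \<cdot> f) = f' \<cdot> ((g' \<cdot> g) \<cdot> f)"
    using Cmp_assoc[OF Cmp_Hom[OF f(1) g(1)] g(2) f(2)] Cmp_assoc[OF f(1) g(1) g(2)] by simp
  then have 1: "(f' \<cdot> g') \<cdot> (g \<cdot> f) = Idn K A" using f g Idn_left[OF f(1)] by simp
  have "(g \<cdot> f) \<cdot> (f' \<cdot> g') = g \<cdot> ((f \<cdot> f') \<cdot> g')"
    using Cmp_assoc[OF Cmp_Hom[OF g(2) f(2)] f(1) g(1)] Cmp_assoc[OF g(2) f(2) f(1)] by simp
  then have 2: "(g \<cdot> f) \<cdot> (f' \<cdot> g') = Idn K C" using f g Idn_left[OF g(2)] by simp
  show ?thesis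
    using Iso_witness[OF Cmp_Hom[OF f(1) g(1)] Cmp_Hom[OF g(2) f(2)] 1 2]
    unfolding isomorphic_def by blast
qed

lemma inv_ar_Hom: assumes "f \<in> Iso K A B" shows "inv_ar K f \<in> Hom K B A"
proof -
  have f: "f \<in> Hom K A B" using assms by (simp add: Iso_def)
  obtain g where g: "inverse_ar K f g" using assms unfolding Iso_def by blast
  have "g' = g" if g': "inverse_ar K f g'" for g'
  proof -
    have h: "g \<in> Hom K B A" "g' \<in> Hom K B A" "g' \<cdot> f = Idn K A" "f \<cdot> g = Idn K B"
      using f g g' by (auto simp: inverse_ar_def Hom_def)
    have "g' = g' \<cdot> (f \<cdot> g)" using Idn_right[OF h(2)] h(4) by simp
    also have "\<dots> = (g' \<cdot> f) \<cdot> g" using Cmp_assoc[OF h(1) f h(2)] by simp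
    finally show ?thesis using h(3) Idn_left[OF h(1)] by simp
  qed
  then have "inverse_ar K f (inv_ar K f)" unfolding inv_ar_def using g by (rule theI[rotated])
  then show ?thesis using f by (auto simp: inverse_ar_def Hom_def)
qed

lemma endofunctor_isomorphic:
  assumes F: "endofunctor K F" and i: "isomorphic K A B"
  shows "isomorphic K (Fo F A) (Fo F B)"
proof -
  obtain f where "f \<in> Iso K A B" using i unfolding isomorphic_def by blast
  then obtain g where fg: "f \<in> Hom K A B" "g \<in> Hom K B A" "g \<cdot> f = Idn K A" "f \<cdot> g = Idn K B"
    by (rule IsoE)
  have cmp: "Fa F (v \<cdot> u) = Fa F v \<cdot> Fa F u" if "u \<in> Hom K X Y" "v \<in> Hom K Y Z" for u v X Y Z
    using F that unfolding endofunctor_def by blast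
  have hom: "Fa F f \<in> Hom K (Fo F A) (Fo F B)" "Fa F g \<in> Hom K (Fo F B) (Fo F A)"
    using F fg unfolding endofunctor_def by blast+
  have idn: "Fa F (Idn K A) = Idn K (Fo F A)" "Fa F (Idn K B) = Idn K (Fo F B)"
    using F isomorphic_Ob[OF i] unfolding endofunctor_def by blast+
  show ?thesis
    using Iso_witness[OF hom] cmp[OF fg(1,2)] cmp[OF fg(2,1)] fg(3,4) idn
    unfolding isomorphic_def by auto
qed

lemma nat_iso_isomorphic: "nat_iso K F F' \<eta> \<Longrightarrow> A \<in> Ob K \<Longrightarrow> isomorphic K (Fo F A) (Fo F' A)"
  unfolding nat_iso_def isomorphic_def by blast

end

context additive_category
begin

lemma additive_functor_Zero:
  assumes F: "additive_functor K F" and AB: "A \<in> Ob K" "B \<in> Ob K"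
  shows "Fa F (Zero K A B) = Zero K (Fo F A) (Fo F B)"
proof (rule Add_idem)
  have z: "Zero K A B \<in> Hom K A B" using Zero_Hom AB by blast
  show "Fa F (Zero K A B) \<in> Hom K (Fo F A) (Fo F B)"
    using F z unfolding additive_functor_def endofunctor_def by blast
  have "Fa F (Zero K A B \<boxplus> Zero K A B) = Fa F (Zero K A B) \<boxplus> Fa F (Zero K A B)"
    using F z unfolding additive_functor_def by blast
  then show "Fa F (Zero K A B) \<boxplus> Fa F (Zero K A B) = Fa F (Zero K A B)" using Add_Zero[OF z] by simp
qed

lemma additive_functor_zero_object:
  assumes F: "additive_functor K F" and Z: "zero_object K Z"
  shows "zero_object K (Fo F Z)"
proof (rule zero_objectI)
  have ZO: "Z \<in> Ob K" using Z by (simp add: zero_object_def)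
  then show "Fo F Z \<in> Ob K" using F unfolding additive_functor_def endofunctor_def by blast
  have "Fa F (Idn K Z) = Idn K (Fo F Z)"
    using F ZO unfolding additive_functor_def endofunctor_def by blast
  then show "Idn K (Fo F Z) = Zero K (Fo F Z) (Fo F Z)"
    using zero_object_from[OF Z Idn_Hom[OF ZO]] additive_functor_Zero[OF F ZO ZO] by simp
qed

lemma additive_functor_biproduct:
  assumes F: "additive_functor K F" and b: "biproduct K A B E i j p q"
  shows "biproduct K (Fo F A) (Fo F B) (Fo F E) (Fa F i) (Fa F j) (Fa F p) (Fa F q)"
proof -
  have m: "i \<in> Hom K A E" "j \<in> Hom K B E" "p \<in> Hom K E A" "q \<in> Hom K E B"
    and e: "p \<cdot> i = Idn K A" "q \<cdot> j = Idn K B" "q \<cdot> i = Zero K A B" "p \<cdot> j = Zero K B A"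
      "(i \<cdot> p) \<boxplus> (j \<cdot> q) = Idn K E"
    using b by (auto simp: biproduct_def)
  have O: "A \<in> Ob K" "B \<in> Ob K" "E \<in> Ob K" using Hom_Ob m by blast+
  have hom: "Fa F u \<in> Hom K (Fo F X) (Fo F Y)" if "u \<in> Hom K X Y" for u X Y
    using F that unfolding additive_functor_def endofunctor_def by blast
  have cmp: "Fa F (v \<cdot> u) = Fa F v \<cdot> Fa F u" if "u \<in> Hom K X Y" "v \<in> Hom K Y Z" for u v X Y Z
    using F that unfolding additive_functor_def endofunctor_def by blast
  have idn: "Fa F (Idn K X) = Idn K (Fo F X)" if "X \<in> Ob K" for X
    using F that unfolding additive_functor_def endofunctor_def by blast
  have add: "Fa F (u \<boxplus> v) = Fa F u \<boxplus> Fa F v" if "u \<in> Hom K X Y" "v \<in> Hom K X Y" for u v X Y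
    using F that unfolding additive_functor_def by blast
  have "Fa F i \<cdot> Fa F p \<boxplus> Fa F j \<cdot> Fa F q = Idn K (Fo F E)"
    using add[OF Cmp_Hom[OF m(3,1)] Cmp_Hom[OF m(4,2)]] cmp[OF m(3,1)] cmp[OF m(4,2)] e(5) idn[OF O(3)]
    by simp
  then show ?thesis
    unfolding biproduct_def
    using hom[OF m(1)] hom[OF m(2)] hom[OF m(3)] hom[OF m(4)] cmp[OF m(1,3)] cmp[OF m(2,4)]
      cmp[OF m(1,4)] cmp[OF m(2,3)] e idn O additive_functor_Zero[OF F] by simp
qed

end

section \<open>Retracts and thick subcategories\<close>

context triangulated_category
begin

text \<open>If \<open>r s = 1\<close>, the third map of the triangle on \<open>s\<close> is killed by the split monomorphism
  \<open>\<Sigma> s\<close>, so it vanishes and the second map is an epimorphism. The complementary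
  idempotent \<open>1 - s r\<close> kills \<open>s\<close> and hence factors through the cone, which is then the other
  summand.\<close>

lemma retract_biproduct:
  assumes s: "s \<in> Hom K A E" and r: "r \<in> Hom K E A" and rs: "r \<cdot> s = Idn K A"
  shows "\<exists>C j q. biproduct K A C E s j r q"
proof -
  have O: "A \<in> Ob K" "E \<in> Ob K" using Hom_Ob[OF s] by auto
  obtain C q t where d: "dtriangle K A E C s q t" using TR1_cone[OF s] by blast
  have qt: "q \<in> Hom K E C" "t \<in> Hom K C (Fo (Sh K) A)"
    using d by (auto simp: dtriangle_def triangle_def)
  have C: "C \<in> Ob K" using Hom_Ob[OF qt(1)] by simp
  have d1: "dtriangle K E C (Fo (Sh K) A) q t (Neg K (Fa (Sh K) s))"
    using d TR2 by (auto simp: dtriangle_def)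
  have d2: "dtriangle K C (Fo (Sh K) A) (Fo (Sh K) E) t (Neg K (Fa (Sh K) s))
      (Neg K (Fa (Sh K) q))"
    using d1 TR2 by (auto simp: dtriangle_def)
  have ss: "Fa (Sh K) s \<in> Hom K (Fo (Sh K) A) (Fo (Sh K) E)" using shift_Hom[OF s] .
  have sr: "Fa (Sh K) r \<in> Hom K (Fo (Sh K) E) (Fo (Sh K) A)" using shift_Hom[OF r] .
  have n0: "Neg K (Fa (Sh K) s) \<cdot> t = Zero K C (Fo (Sh K) E)" using dtriangle_Cmp[OF d2] .
  have st: "Fa (Sh K) s \<cdot> t \<in> Hom K C (Fo (Sh K) E)" using Cmp_Hom[OF qt(2) ss] .
  have "Fa (Sh K) s \<cdot> t = (Fa (Sh K) s \<cdot> t) \<boxplus> (Neg K (Fa (Sh K) s) \<cdot> t)"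
    using n0 Add_Zero[OF st] by simp
  also have "\<dots> = (Fa (Sh K) s \<boxplus> Neg K (Fa (Sh K) s)) \<cdot> t"
    using Cmp_Add_right[OF qt(2) ss Neg_Hom[OF ss]] by simp
  also have "\<dots> = Zero K C (Fo (Sh K) E)"
    using Neg_right[OF ss] Zero_Cmp[OF qt(2) shift_Ob[OF O(2)]] by simp
  finally have s0: "Fa (Sh K) s \<cdot> t = Zero K C (Fo (Sh K) E)" .
  have "t = (Fa (Sh K) r \<cdot> Fa (Sh K) s) \<cdot> t"
    using Idn_left[OF qt(2)] shift_Cmp[OF s r] rs shift_Idn[OF O(1)] by simp
  also have "\<dots> = Fa (Sh K) r \<cdot> (Fa (Sh K) s \<cdot> t)" using Cmp_assoc[OF qt(2) ss sr] .
  finally have t0: "t = Zero K C (Fo (Sh K) A)" using s0 Cmp_Zero[OF sr C] by simp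
  \<comment> \<open>As \<open>t = 0\<close>, only the zero map out of \<open>C\<close> is killed by \<open>q\<close>, so maps out of \<open>C\<close> may be
    compared after composing with \<open>q\<close>.\<close>
  have epi: "u = Zero K C X" if u: "u \<in> Hom K C X" "u \<cdot> q = Zero K E X" for u X
  proof -
    obtain c where "c \<in> Hom K (Fo (Sh K) A) X" "c \<cdot> t = u"
      using dtriangle_weak_cokernel[OF d1 u] by blast
    then show ?thesis using t0 Cmp_Zero C by blast
  qed
  have qs: "q \<cdot> s = Zero K A C" using dtriangle_Cmp[OF d] .
  have e: "s \<cdot> r \<in> Hom K E E" using Cmp_Hom[OF r s] .
  have ne: "Neg K (s \<cdot> r) \<in> Hom K E E" using Neg_Hom[OF e] .
  let ?w = "Idn K E \<boxplus> Neg K (s \<cdot> r)"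
  have w: "?w \<in> Hom K E E" using Add_Hom[OF Idn_Hom[OF O(2)] ne] .
  have ew: "(s \<cdot> r) \<boxplus> ?w = Idn K E"
  proof -
    interpret H: comm_group "hom_group K E E" using hom_comm_group[OF O(2) O(2)] .
    have "(s \<cdot> r) \<boxplus> (Idn K E \<boxplus> Neg K (s \<cdot> r)) = Idn K E \<boxplus> ((s \<cdot> r) \<boxplus> Neg K (s \<cdot> r))"
      using H.m_lcomm[of "s \<cdot> r" "Idn K E" "Neg K (s \<cdot> r)"] e ne Idn_Hom[OF O(2)]
      by (simp add: hom_group_def)
    then show ?thesis using Neg_right[OF e] Add_Zero[OF Idn_Hom[OF O(2)]] by simp
  qed
  have ws: "?w \<cdot> s = Zero K A E"
  proof -
    have "(s \<cdot> r) \<cdot> s = Idn K E \<cdot> s"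
      using Cmp_assoc[OF s r s] rs Idn_right[OF s] Idn_left[OF s] by simp
    then have "?w \<cdot> s = ((s \<cdot> r) \<boxplus> Neg K (s \<cdot> r)) \<cdot> s"
      using Cmp_Add_right[OF s Idn_Hom[OF O(2)] ne] Cmp_Add_right[OF s e ne] by simp
    then show ?thesis using Neg_right[OF e] Zero_Cmp[OF s O(2)] by simp
  qed
  obtain j where j: "j \<in> Hom K C E" "j \<cdot> q = ?w"
    using dtriangle_weak_cokernel[OF d w ws] by blast
  have jq: "j \<cdot> q \<in> Hom K E E" using Cmp_Hom[OF qt(1) j(1)] .
  have split: "(s \<cdot> r) \<boxplus> (j \<cdot> q) = Idn K E" using ew j(2) by simp
  have rj: "r \<cdot> j = Zero K C A"
  proof (rule epi)
    show rj': "r \<cdot> j \<in> Hom K C A" using Cmp_Hom[OF j(1) r] .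
    have h: "r \<cdot> (j \<cdot> q) \<in> Hom K E A" using Cmp_Hom[OF jq r] .
    have "r \<cdot> (s \<cdot> r) = r" using Cmp_assoc[OF r s r] rs Idn_left[OF r] by simp
    then have "(r \<cdot> (j \<cdot> q)) \<boxplus> r = (r \<cdot> (s \<cdot> r)) \<boxplus> (r \<cdot> (j \<cdot> q))"
      using comm_group.axioms(1)[OF hom_comm_group[OF O(2) O(1)]] h r
        comm_monoid.m_comm[of "hom_group K E A" "r \<cdot> (j \<cdot> q)" r]
      by (simp add: hom_group_def)
    also have "\<dots> = r" using Cmp_Add_left[OF e jq r] split Idn_right[OF r] by simp
    finally have "(r \<cdot> (j \<cdot> q)) \<boxplus> r = Zero K E A \<boxplus> r" using Zero_Add[OF r] by simp
    then have "r \<cdot> (j \<cdot> q) = Zero K E A" using Add_cancel[OF h Zero_Hom[OF O(2,1)] r] by simp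
    then show "(r \<cdot> j) \<cdot> q = Zero K E A" using Cmp_assoc[OF qt(1) j(1) r] by simp
  qed
  have qj: "q \<cdot> j = Idn K C"
  proof -
    have qj': "q \<cdot> j \<in> Hom K C C" using Cmp_Hom[OF j(1) qt(1)] .
    have "q \<cdot> (s \<cdot> r) = Zero K E C" using Cmp_assoc[OF r s qt(1)] qs Zero_Cmp[OF r C] by simp
    then have "q = q \<cdot> (j \<cdot> q)"
      using Cmp_Add_left[OF e jq qt(1)] split Idn_right[OF qt(1)] Zero_Add[OF Cmp_Hom[OF jq qt(1)]]
      by simp
    then have qjq: "(q \<cdot> j) \<cdot> q = Idn K C \<cdot> q"
      using Cmp_assoc[OF qt(1) j(1) qt(1)] Idn_left[OF qt(1)] by simp
    have nj: "Neg K (q \<cdot> j) \<in> Hom K C C" using Neg_Hom[OF qj'] .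
    have "(Idn K C \<boxplus> Neg K (q \<cdot> j)) \<cdot> q = ((q \<cdot> j) \<boxplus> Neg K (q \<cdot> j)) \<cdot> q"
      using Cmp_Add_right[OF qt(1) Idn_Hom[OF C] nj] Cmp_Add_right[OF qt(1) qj' nj] qjq by simp
    also have "\<dots> = Zero K E C" using Neg_right[OF qj'] Zero_Cmp[OF qt(1) C] by simp
    finally have "Idn K C \<boxplus> Neg K (q \<cdot> j) = Zero K C C"
      using epi[OF Add_Hom[OF Idn_Hom[OF C] nj]] by simp
    then show ?thesis using Add_cancel[OF Idn_Hom[OF C] qj' nj] Neg_right[OF qj'] by simp
  qed
  have "biproduct K A C E s j r q"
    unfolding biproduct_def using s j(1) r qt(1) rs qj qs rj split by simp
  then show ?thesis by blast
qed

end

definition thick_subcategory :: "('o, 'm, 'z) tricat_scheme \<Rightarrow> 'o set \<Rightarrow> bool" where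
  "thick_subcategory K I \<longleftrightarrow> triangulated_subcategory K I \<and>
     (\<forall>A B E i j p q. biproduct K A B E i j p q \<and> E \<in> I \<longrightarrow> A \<in> I \<and> B \<in> I)"

lemma thick_ideal_iff:
  "thick_ideal K I \<longleftrightarrow> thick_subcategory K I \<and>
     (\<forall>A\<in>I. \<forall>B\<in>Ob K. A \<boxtimes>\<^bsub>K\<^esub> B \<in> I \<and> B \<boxtimes>\<^bsub>K\<^esub> A \<in> I)"
  unfolding thick_ideal_def thick_subcategory_def by (simp only: conj_assoc)

lemma thick_subcategoryI:
  assumes "I \<subseteq> Ob K"
    and "\<And>A B. A \<in> I \<Longrightarrow> isomorphic K A B \<Longrightarrow> B \<in> I"
    and "\<And>Z. zero_object K Z \<Longrightarrow> Z \<in> I"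
    and "\<And>A. A \<in> Ob K \<Longrightarrow> A \<in> I \<longleftrightarrow> Fo (Sh K) A \<in> I"
    and "\<And>A B C f g h. dtriangle K A B C f g h \<Longrightarrow> A \<in> I \<Longrightarrow> B \<in> I \<Longrightarrow> C \<in> I"
    and "\<And>A B E i j p q. biproduct K A B E i j p q \<Longrightarrow> E \<in> I \<Longrightarrow> A \<in> I \<and> B \<in> I"
  shows "thick_subcategory K I"
  unfolding thick_subcategory_def triangulated_subcategory_def
  using assms by (intro conjI allI impI ballI) (simp_all | metis | blast)+

lemma thick_subcategoryD:
  assumes "thick_subcategory K I"
  shows "I \<subseteq> Ob K"
    and "A \<in> I \<Longrightarrow> isomorphic K A B \<Longrightarrow> B \<in> I"
    and "zero_object K Z \<Longrightarrow> Z \<in> I"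
    and "A \<in> Ob K \<Longrightarrow> A \<in> I \<longleftrightarrow> Fo (Sh K) A \<in> I"
    and "dtriangle K A B C f g h \<Longrightarrow> A \<in> I \<Longrightarrow> B \<in> I \<Longrightarrow> C \<in> I"
    and "biproduct K A B E i j p q \<Longrightarrow> E \<in> I \<Longrightarrow> A \<in> I \<and> B \<in> I"
proof -
  note S = assms[unfolded thick_subcategory_def triangulated_subcategory_def]
  show "I \<subseteq> Ob K" using S by (elim conjE)
  show "A \<in> I \<Longrightarrow> isomorphic K A B \<Longrightarrow> B \<in> I" using S by (elim conjE) metis
  show "zero_object K Z \<Longrightarrow> Z \<in> I" using S by (elim conjE) metis
  show "A \<in> Ob K \<Longrightarrow> A \<in> I \<longleftrightarrow> Fo (Sh K) A \<in> I" using S by (elim conjE) metis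
  show "dtriangle K A B C f g h \<Longrightarrow> A \<in> I \<Longrightarrow> B \<in> I \<Longrightarrow> C \<in> I" using S by (elim conjE) metis
  show "biproduct K A B E i j p q \<Longrightarrow> E \<in> I \<Longrightarrow> A \<in> I \<and> B \<in> I" using S by (elim conjE) metis
qed

context triangulated_category
begin

lemma thick_subcategory_Inter:
  assumes S: "\<And>x. x \<in> X \<Longrightarrow> thick_subcategory K (S x)"
  shows "thick_subcategory K {A \<in> Ob K. \<forall>x\<in>X. A \<in> S x}"
proof (rule thick_subcategoryI)
  fix A assume "A \<in> Ob K"
  then show "A \<in> {A \<in> Ob K. \<forall>x\<in>X. A \<in> S x} \<longleftrightarrow> Fo (Sh K) A \<in> {A \<in> Ob K. \<forall>x\<in>X. A \<in> S x}"
    using thick_subcategoryD(4)[OF S] shift_Ob by simp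
next
  fix A B C f g h
  assume d: "dtriangle K A B C f g h"
    and "A \<in> {A \<in> Ob K. \<forall>x\<in>X. A \<in> S x}" "B \<in> {A \<in> Ob K. \<forall>x\<in>X. A \<in> S x}"
  then have "C \<in> S x" if "x \<in> X" for x using thick_subcategoryD(5)[OF S d] that by simp
  moreover have "C \<in> Ob K" using d Hom_Ob unfolding dtriangle_def triangle_def by blast
  ultimately show "C \<in> {A \<in> Ob K. \<forall>x\<in>X. A \<in> S x}" by simp
next
  fix A B E i j p q
  assume b: "biproduct K A B E i j p q" and "E \<in> {A \<in> Ob K. \<forall>x\<in>X. A \<in> S x}"
  then have "A \<in> S x \<and> B \<in> S x" if "x \<in> X" for x using thick_subcategoryD(6)[OF S b] that by simp
  moreover have "A \<in> Ob K \<and> B \<in> Ob K" using b Hom_Ob unfolding biproduct_def by blast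
  ultimately show "A \<in> {A \<in> Ob K. \<forall>x\<in>X. A \<in> S x} \<and> B \<in> {A \<in> Ob K. \<forall>x\<in>X. A \<in> S x}" by simp
next
  fix A B assume "A \<in> {A \<in> Ob K. \<forall>x\<in>X. A \<in> S x}" "isomorphic K A B"
  then show "B \<in> {A \<in> Ob K. \<forall>x\<in>X. A \<in> S x}"
    using isomorphic_Ob[of A B] thick_subcategoryD(2)[OF S] by blast
next
  fix Z assume "zero_object K Z"
  then show "Z \<in> {A \<in> Ob K. \<forall>x\<in>X. A \<in> S x}"
    using thick_subcategoryD(3)[OF S] by (simp add: zero_object_def)
qed simp

text \<open>Translates of thick ideals are preimages under the functors \<open>T\<^sub>g\<close>, and colon ideals are
  intersections of preimages under tensoring, so both inherit thickness from here.\<close>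

lemma thick_subcategory_preimage:
  assumes F: "exact_functor K F \<phi>" and I: "thick_subcategory K I"
  shows "thick_subcategory K {A \<in> Ob K. Fo F A \<in> I}"
proof -
  have add: "additive_functor K F" and fn: "endofunctor K F"
    using F by (auto simp: exact_functor_def additive_functor_def)
  show ?thesis
  proof (rule thick_subcategoryI)
    fix A B assume "A \<in> {A \<in> Ob K. Fo F A \<in> I}" "isomorphic K A B"
    then show "B \<in> {A \<in> Ob K. Fo F A \<in> I}"
      using isomorphic_Ob[of A B] endofunctor_isomorphic[OF fn] thick_subcategoryD(2)[OF I] by blast
  next
    fix Z assume "zero_object K Z"
    then show "Z \<in> {A \<in> Ob K. Fo F A \<in> I}"
      using additive_functor_zero_object[OF add] thick_subcategoryD(3)[OF I]
      by (simp add: zero_object_def)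
  next
    fix A assume A: "A \<in> Ob K"
    have n: "nat_iso K (fun_comp F (Sh K)) (fun_comp (Sh K) F) \<phi>"
      using F by (simp add: exact_functor_def)
    have i: "isomorphic K (Fo F (Fo (Sh K) A)) (Fo (Sh K) (Fo F A))"
      using nat_iso_isomorphic[OF n A] by (simp add: fun_comp_def)
    have "Fo F A \<in> Ob K" using fn A by (simp add: endofunctor_def)
    then have "Fo F A \<in> I \<longleftrightarrow> Fo (Sh K) (Fo F A) \<in> I" using thick_subcategoryD(4)[OF I] by simp
    also have "\<dots> \<longleftrightarrow> Fo F (Fo (Sh K) A) \<in> I"
      using thick_subcategoryD(2)[OF I _ i] thick_subcategoryD(2)[OF I _ isomorphic_sym[OF i]] by blast
    finally show "A \<in> {A \<in> Ob K. Fo F A \<in> I} \<longleftrightarrow> Fo (Sh K) A \<in> {A \<in> Ob K. Fo F A \<in> I}"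
      using A shift_Ob by simp
  next
    fix A B C f g h
    assume d: "dtriangle K A B C f g h"
      and AB: "A \<in> {A \<in> Ob K. Fo F A \<in> I}" "B \<in> {A \<in> Ob K. Fo F A \<in> I}"
    have "dtriangle K (Fo F A) (Fo F B) (Fo F C) (Fa F f) (Fa F g) (\<phi> A \<cdot> Fa F h)"
      using F d unfolding exact_functor_def by blast
    then have "Fo F C \<in> I" using thick_subcategoryD(5)[OF I] AB by blast
    moreover have "C \<in> Ob K" using d Hom_Ob unfolding dtriangle_def triangle_def by blast
    ultimately show "C \<in> {A \<in> Ob K. Fo F A \<in> I}" by simp
  next
    fix A B E i j p q
    assume b: "biproduct K A B E i j p q" and E: "E \<in> {A \<in> Ob K. Fo F A \<in> I}"
    have "Fo F A \<in> I \<and> Fo F B \<in> I"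
      using thick_subcategoryD(6)[OF I additive_functor_biproduct[OF add b]] E by simp
    moreover have "A \<in> Ob K \<and> B \<in> Ob K" using b Hom_Ob unfolding biproduct_def by blast
    ultimately show "A \<in> {A \<in> Ob K. Fo F A \<in> I} \<and> B \<in> {A \<in> Ob K. Fo F A \<in> I}" by simp
  qed simp
qed

lemma thick_subcategory_Union_chain:
  assumes c: "subset.chain (Collect (thick_subcategory K)) \<C>" and ne: "\<C> \<noteq> {}"
  shows "thick_subcategory K (\<Union>\<C>)"
proof -
  have S: "thick_subcategory K I" if "I \<in> \<C>" for I
    using c that by (auto simp: subset.chain_def)
  have lin: "I \<subseteq> J \<or> J \<subseteq> I" if "I \<in> \<C>" "J \<in> \<C>" for I J
    using c that by (auto simp: subset.chain_def)
  show ?thesis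
  proof (rule thick_subcategoryI)
    show "\<Union>\<C> \<subseteq> Ob K" using thick_subcategoryD(1)[OF S] by blast
  next
    fix A B assume "A \<in> \<Union>\<C>" "isomorphic K A B"
    then show "B \<in> \<Union>\<C>" using thick_subcategoryD(2)[OF S] by blast
  next
    fix Z assume "zero_object K Z"
    then show "Z \<in> \<Union>\<C>" using thick_subcategoryD(3)[OF S] ne by blast
  next
    fix A assume "A \<in> Ob K"
    then show "A \<in> \<Union>\<C> \<longleftrightarrow> Fo (Sh K) A \<in> \<Union>\<C>" using thick_subcategoryD(4)[OF S] by blast
  next
    fix A B C f g h assume d: "dtriangle K A B C f g h" and "A \<in> \<Union>\<C>" "B \<in> \<Union>\<C>"
    then obtain I J where IJ: "I \<in> \<C>" "J \<in> \<C>" "A \<in> I" "B \<in> J" by blast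
    then have "A \<in> J \<and> B \<in> J \<or> A \<in> I \<and> B \<in> I" using lin by blast
    then show "C \<in> \<Union>\<C>" using thick_subcategoryD(5)[OF S d] IJ by blast
  next
    fix A B E i j p q assume b: "biproduct K A B E i j p q" and "E \<in> \<Union>\<C>"
    then show "A \<in> \<Union>\<C> \<and> B \<in> \<Union>\<C>" using thick_subcategoryD(6)[OF S b] by blast
  qed
qed

end

section \<open>Primes in a monoidal triangulated category\<close>

definition left_colon :: "('o, 'm, 'z) mtcat_scheme \<Rightarrow> 'o set \<Rightarrow> 'o set \<Rightarrow> 'o set" where
  "left_colon K P S = {X \<in> Ob K. \<forall>Y\<in>S. X \<boxtimes>\<^bsub>K\<^esub> Y \<in> P}"

definition right_colon :: "('o, 'm, 'z) mtcat_scheme \<Rightarrow> 'o set \<Rightarrow> 'o set \<Rightarrow> 'o set" where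
  "right_colon K P S = {Y \<in> Ob K. \<forall>X\<in>S. X \<boxtimes>\<^bsub>K\<^esub> Y \<in> P}"

lemma thick_idealD:
  assumes "thick_ideal K I"
  shows "thick_subcategory K I"
    and "I \<subseteq> Ob K"
    and "A \<in> I \<Longrightarrow> isomorphic K A B \<Longrightarrow> B \<in> I"
    and "A \<in> I \<Longrightarrow> B \<in> Ob K \<Longrightarrow> A \<boxtimes>\<^bsub>K\<^esub> B \<in> I"
    and "A \<in> I \<Longrightarrow> B \<in> Ob K \<Longrightarrow> B \<boxtimes>\<^bsub>K\<^esub> A \<in> I"
  using assms thick_subcategoryD(1,2)[of K I] unfolding thick_ideal_iff by blast+

lemma SpcD:
  assumes "P \<in> Spc K"
  shows "thick_ideal K P" and "P \<noteq> Ob K" and "P \<subseteq> Ob K"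
    and "thick_ideal K I \<Longrightarrow> thick_ideal K J \<Longrightarrow> tensor_set K I J \<subseteq> P \<Longrightarrow> I \<subseteq> P \<or> J \<subseteq> P"
  using assms thick_idealD(2)[of K P] by (auto simp: Spc_def prime_ideal_def)

context monoidal_category
begin

lemma tensor_isomorphic:
  assumes "isomorphic K A A'" "isomorphic K B B'"
  shows "isomorphic K (A \<boxtimes> B) (A' \<boxtimes> B')"
proof -
  obtain f where "f \<in> Iso K A A'" using assms(1) unfolding isomorphic_def by blast
  then obtain f' where f: "f \<in> Hom K A A'" "f' \<in> Hom K A' A" "f' \<cdot> f = Idn K A" "f \<cdot> f' = Idn K A'"
    by (rule IsoE)
  obtain g where "g \<in> Iso K B B'" using assms(2) unfolding isomorphic_def by blast
  then obtain g' where g: "g \<in> Hom K B B'" "g' \<in> Hom K B' B" "g' \<cdot> g = Idn K B" "g \<cdot> g' = Idn K B'"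
    by (rule IsoE)
  have "(f' \<star> g') \<cdot> (f \<star> g) = Idn K (A \<boxtimes> B)"
    using Tar_Cmp[OF f(1,2) g(1,2)] f(3) g(3) Tar_Idn Hom_Ob f(1) g(1) by metis
  moreover have "(f \<star> g) \<cdot> (f' \<star> g') = Idn K (A' \<boxtimes> B')"
    using Tar_Cmp[OF f(2,1) g(2,1)] f(4) g(4) Tar_Idn Hom_Ob f(1) g(1) by metis
  ultimately show ?thesis
    using Iso_witness[OF Tar_Hom[OF f(1) g(1)] Tar_Hom[OF f(2) g(2)]]
    unfolding isomorphic_def by blast
qed

lemma assoc_isomorphic:
  "\<lbrakk>A \<in> Ob K; B \<in> Ob K; C \<in> Ob K\<rbrakk> \<Longrightarrow> isomorphic K ((A \<boxtimes> B) \<boxtimes> C) (A \<boxtimes> (B \<boxtimes> C))"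
  using Asc_Iso unfolding isomorphic_def by blast

lemma left_unit_isomorphic: "A \<in> Ob K \<Longrightarrow> isomorphic K (Unit K \<boxtimes> A) A"
  using Lun_Iso unfolding isomorphic_def by blast

end

context monoidal_triangulated_category
begin

lemma thick_ideal_assoc:
  assumes I: "thick_ideal K I" and O: "A \<in> Ob K" "B \<in> Ob K" "C \<in> Ob K"
  shows "(A \<boxtimes> B) \<boxtimes> C \<in> I \<longleftrightarrow> A \<boxtimes> (B \<boxtimes> C) \<in> I"
  using thick_idealD(3)[OF I _ assoc_isomorphic[OF O]]
    thick_idealD(3)[OF I _ isomorphic_sym[OF assoc_isomorphic[OF O]]] by blast

text \<open>For the colon ideal to be two-sided, the divisor only has to absorb tensoring on the inner
  side, and that up to isomorphism. The case of interest beyond ideals is the set of all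
  \<open>C \<otimes> B\<close> for a fixed \<open>B\<close>.\<close>

lemma thick_ideal_left_colon:
  assumes P: "thick_ideal K P" and S: "S \<subseteq> Ob K"
    and absorb: "\<And>C Y. C \<in> Ob K \<Longrightarrow> Y \<in> S \<Longrightarrow> \<exists>Y'\<in>S. isomorphic K Y' (C \<boxtimes> Y)"
  shows "thick_ideal K (left_colon K P S)"
proof -
  have "thick_subcategory K {A \<in> Ob K. A \<boxtimes> Y \<in> P}" if Y: "Y \<in> S" for Y
  proof -
    obtain \<phi> where "exact_functor K (tensor_right K Y) \<phi>" using tensor_right_exact[of Y] Y S by blast
    from thick_subcategory_preimage[OF this thick_idealD(1)[OF P]]
    show ?thesis by (simp add: tensor_right_def)
  qed
  from thick_subcategory_Inter[of S, OF this]
  have "thick_subcategory K {A \<in> Ob K. \<forall>Y\<in>S. A \<in> {A \<in> Ob K. A \<boxtimes> Y \<in> P}}" .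
  moreover have "{A \<in> Ob K. \<forall>Y\<in>S. A \<in> {A \<in> Ob K. A \<boxtimes> Y \<in> P}} = left_colon K P S"
    unfolding left_colon_def by auto
  ultimately have "thick_subcategory K (left_colon K P S)" by simp
  moreover have "A \<boxtimes> B \<in> left_colon K P S" "B \<boxtimes> A \<in> left_colon K P S"
    if A: "A \<in> left_colon K P S" and B: "B \<in> Ob K" for A B
  proof -
    have AO: "A \<in> Ob K" using A by (simp add: left_colon_def)
    have "(A \<boxtimes> B) \<boxtimes> Y \<in> P" if Y: "Y \<in> S" for Y
    proof -
      obtain Y' where Y': "Y' \<in> S" "isomorphic K Y' (B \<boxtimes> Y)" using absorb[OF B Y] by blast
      have "A \<boxtimes> Y' \<in> P" using A Y'(1) by (simp add: left_colon_def)
      then have "A \<boxtimes> (B \<boxtimes> Y) \<in> P"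
        using thick_idealD(3)[OF P _ tensor_isomorphic[OF isomorphic_refl[OF AO] Y'(2)]] by simp
      then show ?thesis using thick_ideal_assoc[OF P AO B] Y S by blast
    qed
    then show "A \<boxtimes> B \<in> left_colon K P S" using Tob_Ob AO B by (simp add: left_colon_def)
    have "(B \<boxtimes> A) \<boxtimes> Y \<in> P" if Y: "Y \<in> S" for Y
    proof -
      have "B \<boxtimes> (A \<boxtimes> Y) \<in> P" using thick_idealD(5)[OF P _ B] A Y by (simp add: left_colon_def)
      then show ?thesis using thick_ideal_assoc[OF P B AO] Y S by blast
    qed
    then show "B \<boxtimes> A \<in> left_colon K P S" using Tob_Ob AO B by (simp add: left_colon_def)
  qed
  ultimately show ?thesis unfolding thick_ideal_iff by blast
qed

lemma thick_ideal_right_colon: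
  assumes P: "thick_ideal K P" and S: "thick_ideal K S"
  shows "thick_ideal K (right_colon K P S)"
proof -
  have SO: "S \<subseteq> Ob K" using thick_idealD(2)[OF S] .
  have "thick_subcategory K {A \<in> Ob K. X \<boxtimes> A \<in> P}" if X: "X \<in> S" for X
  proof -
    obtain \<phi> where "exact_functor K (tensor_left K X) \<phi>" using tensor_left_exact[of X] X SO by blast
    from thick_subcategory_preimage[OF this thick_idealD(1)[OF P]]
    show ?thesis by (simp add: tensor_left_def)
  qed
  from thick_subcategory_Inter[of S, OF this]
  have "thick_subcategory K {A \<in> Ob K. \<forall>X\<in>S. A \<in> {A \<in> Ob K. X \<boxtimes> A \<in> P}}" .
  moreover have "{A \<in> Ob K. \<forall>X\<in>S. A \<in> {A \<in> Ob K. X \<boxtimes> A \<in> P}} = right_colon K P S"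
    unfolding right_colon_def by auto
  ultimately have "thick_subcategory K (right_colon K P S)" by simp
  moreover have "A \<boxtimes> B \<in> right_colon K P S" "B \<boxtimes> A \<in> right_colon K P S"
    if A: "A \<in> right_colon K P S" and B: "B \<in> Ob K" for A B
  proof -
    have AO: "A \<in> Ob K" using A by (simp add: right_colon_def)
    have "X \<boxtimes> (A \<boxtimes> B) \<in> P" if X: "X \<in> S" for X
    proof -
      have "(X \<boxtimes> A) \<boxtimes> B \<in> P" using thick_idealD(4)[OF P _ B] A X by (simp add: right_colon_def)
      then show ?thesis using thick_ideal_assoc[OF P _ AO B] X SO by blast
    qed
    then show "A \<boxtimes> B \<in> right_colon K P S" using Tob_Ob AO B by (simp add: right_colon_def)
    have "X \<boxtimes> (B \<boxtimes> A) \<in> P" if X: "X \<in> S" for X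
    proof -
      have "(X \<boxtimes> B) \<boxtimes> A \<in> P" using thick_idealD(4)[OF S X B] A by (simp add: right_colon_def)
      then show ?thesis using thick_ideal_assoc[OF P _ B AO] X SO by blast
    qed
    then show "B \<boxtimes> A \<in> right_colon K P S" using Tob_Ob AO B by (simp add: right_colon_def)
  qed
  ultimately show ?thesis unfolding thick_ideal_iff by blast
qed

text \<open>The two colons turn the hypothesis that all \<open>A \<otimes> C \<otimes> B\<close> lie in \<open>P\<close> into a pair of ideals
  containing \<open>A\<close> and \<open>B\<close> whose product lies in \<open>P\<close>, so no description of the ideal
  generated by an object is needed.\<close>

lemma prime_tensor_nonmem:
  assumes P: "P \<in> Spc K" and A: "A \<in> Ob K" "A \<notin> P" and B: "B \<in> Ob K" "B \<notin> P"
  obtains C where "C \<in> Ob K" "A \<boxtimes> (C \<boxtimes> B) \<notin> P"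
proof -
  note tP = SpcD(1)[OF P]
  let ?S = "{C \<boxtimes> B | C. C \<in> Ob K}"
  let ?L = "left_colon K P ?S"
  let ?R = "right_colon K P ?L"
  have L: "thick_ideal K ?L"
  proof (rule thick_ideal_left_colon[OF tP])
    show "?S \<subseteq> Ob K" using Tob_Ob B(1) by auto
    fix D Y assume D: "D \<in> Ob K" and "Y \<in> ?S"
    then obtain C where C: "C \<in> Ob K" "Y = C \<boxtimes> B" by blast
    have "(D \<boxtimes> C) \<boxtimes> B \<in> ?S" using Tob_Ob[OF D C(1)] by blast
    then show "\<exists>Y'\<in>?S. isomorphic K Y' (D \<boxtimes> Y)"
      using assoc_isomorphic[OF D C(1) B(1)] C(2) by blast
  qed
  have "tensor_set K ?L ?R \<subseteq> P" by (auto simp: tensor_set_def right_colon_def)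
  then have "?L \<subseteq> P \<or> ?R \<subseteq> P"
    using SpcD(4)[OF P L thick_ideal_right_colon[OF tP L]] by blast
  moreover have "B \<in> ?R"
  proof -
    have "X \<boxtimes> B \<in> P" if X: "X \<in> ?L" for X
    proof -
      have XO: "X \<in> Ob K" using X by (simp add: left_colon_def)
      have "X \<boxtimes> (Unit K \<boxtimes> B) \<in> P" using X Unit_Ob by (auto simp: left_colon_def)
      then show ?thesis
        using thick_idealD(3)[OF tP _ tensor_isomorphic[OF isomorphic_refl[OF XO]
          left_unit_isomorphic[OF B(1)]]] by simp
    qed
    then show ?thesis using B(1) by (simp add: right_colon_def)
  qed
  ultimately have "A \<notin> ?L" using A B by blast
  then show ?thesis using that A(1) by (auto simp: left_colon_def)
qed

lemma thick_subcategory_retract: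
  assumes I: "thick_subcategory K I" and E: "E \<in> I"
    and u: "u \<in> Hom K U E" and v: "v \<in> Hom K E A" and vu: "v \<cdot> u \<in> Iso K U A"
  shows "A \<in> I"
proof -
  obtain w where w: "w \<in> Hom K A U" "(v \<cdot> u) \<cdot> w = Idn K A" using vu by (rule IsoE)
  have "v \<cdot> (u \<cdot> w) = Idn K A" using w(2) Cmp_assoc[OF w(1) u v] by simp
  then obtain C j q where "biproduct K A C E (u \<cdot> w) j v q"
    using retract_biproduct[OF Cmp_Hom[OF w(1) u] v] by blast
  then show ?thesis using thick_subcategoryD(6)[OF I _ E] by blast
qed

text \<open>A zigzag identity exhibits \<open>A\<close> as a retract of \<open>A \<otimes> A' \<otimes> A\<close>, whether \<open>A'\<close> is a left or a
  right dual of \<open>A\<close>.\<close>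

lemma rigid_semiprime:
  assumes rigid: "left_rigid K \<or> right_rigid K"
    and I: "thick_ideal K I" and A: "A \<in> Ob K"
    and mem: "\<And>C. C \<in> Ob K \<Longrightarrow> (A \<boxtimes> C) \<boxtimes> A \<in> I"
  shows "A \<in> I"
  using rigid
proof
  assume "left_rigid K"
  then obtain A' where d: "left_dual K A A'" using A unfolding left_rigid_def by blast
  then have A': "A' \<in> Ob K" by (simp add: left_dual_def)
  obtain ev coev where e: "ev \<in> Hom K (A' \<boxtimes> A) (Unit K)" "coev \<in> Hom K (Unit K) (A \<boxtimes> A')"
    and z: "Run K A \<cdot> (Idn K A \<star> ev) \<cdot> Asc K A A' A \<cdot> (coev \<star> Idn K A) = Lun K A"
    using d unfolding left_dual_def by blast
  have u: "coev \<star> Idn K A \<in> Hom K (Unit K \<boxtimes> A) ((A \<boxtimes> A') \<boxtimes> A)"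
    using Tar_Hom[OF e(2) Idn_Hom[OF A]] .
  have a: "Asc K A A' A \<in> Hom K ((A \<boxtimes> A') \<boxtimes> A) (A \<boxtimes> (A' \<boxtimes> A))"
    using Asc_Iso[OF A A' A] by (simp add: Iso_def)
  have b: "Idn K A \<star> ev \<in> Hom K (A \<boxtimes> (A' \<boxtimes> A)) (A \<boxtimes> Unit K)"
    using Tar_Hom[OF Idn_Hom[OF A] e(1)] .
  have c: "Run K A \<in> Hom K (A \<boxtimes> Unit K) A" using Run_Iso[OF A] by (simp add: Iso_def)
  show ?thesis
    using thick_subcategory_retract[OF thick_idealD(1)[OF I] mem[OF A'] u
        Cmp_Hom[OF a Cmp_Hom[OF b c]]] z Lun_Iso[OF A] by simp
next
  assume "right_rigid K"
  then obtain A' where d: "left_dual K A' A"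
    using A unfolding right_rigid_def right_dual_def by blast
  then have A': "A' \<in> Ob K" by (simp add: left_dual_def)
  obtain ev coev where e: "ev \<in> Hom K (A \<boxtimes> A') (Unit K)" "coev \<in> Hom K (Unit K) (A' \<boxtimes> A)"
    and z: "Lun K A \<cdot> (ev \<star> Idn K A) \<cdot> inv_ar K (Asc K A A' A) \<cdot> (Idn K A \<star> coev) = Run K A"
    using d unfolding left_dual_def by blast
  have u: "Idn K A \<star> coev \<in> Hom K (A \<boxtimes> Unit K) (A \<boxtimes> (A' \<boxtimes> A))"
    using Tar_Hom[OF Idn_Hom[OF A] e(2)] .
  have a: "inv_ar K (Asc K A A' A) \<in> Hom K (A \<boxtimes> (A' \<boxtimes> A)) ((A \<boxtimes> A') \<boxtimes> A)"
    using inv_ar_Hom[OF Asc_Iso[OF A A' A]] .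
  have b: "ev \<star> Idn K A \<in> Hom K ((A \<boxtimes> A') \<boxtimes> A) (Unit K \<boxtimes> A)"
    using Tar_Hom[OF e(1) Idn_Hom[OF A]] .
  have c: "Lun K A \<in> Hom K (Unit K \<boxtimes> A) A" using Lun_Iso[OF A] by (simp add: Iso_def)
  have "A \<boxtimes> (A' \<boxtimes> A) \<in> I" using mem[OF A'] thick_ideal_assoc[OF I A A' A] by simp
  from thick_subcategory_retract[OF thick_idealD(1)[OF I] this u Cmp_Hom[OF a Cmp_Hom[OF b c]]]
  show ?thesis using z Run_Iso[OF A] by simp
qed

lemma thick_ideal_Inter:
  assumes X: "\<And>I. I \<in> X \<Longrightarrow> thick_ideal K I"
  shows "thick_ideal K {A \<in> Ob K. \<forall>I\<in>X. A \<in> I}"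
  unfolding thick_ideal_iff
proof (intro conjI ballI)
  show "thick_subcategory K {A \<in> Ob K. \<forall>I\<in>X. A \<in> I}"
    by (rule thick_subcategory_Inter) (rule thick_idealD(1)[OF X])
  fix A B assume A: "A \<in> {A \<in> Ob K. \<forall>I\<in>X. A \<in> I}" and B: "B \<in> Ob K"
  have "A \<boxtimes> B \<in> I \<and> B \<boxtimes> A \<in> I" if I: "I \<in> X" for I
  proof -
    have "A \<in> I" using A I by simp
    then show ?thesis using thick_idealD(4,5)[OF X[OF I] _ B] by simp
  qed
  then show "A \<boxtimes> B \<in> {A \<in> Ob K. \<forall>I\<in>X. A \<in> I}" "B \<boxtimes> A \<in> {A \<in> Ob K. \<forall>I\<in>X. A \<in> I}"
    using A B Tob_Ob by simp_all
qed

lemma thick_ideal_Union_chain: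
  assumes c: "subset.chain (Collect (thick_ideal K)) \<C>" and ne: "\<C> \<noteq> {}"
  shows "thick_ideal K (\<Union>\<C>)"
proof -
  have "subset.chain (Collect (thick_subcategory K)) \<C>"
    using c thick_idealD(1) by (auto simp: subset.chain_def)
  then have "thick_subcategory K (\<Union>\<C>)" using thick_subcategory_Union_chain ne by blast
  moreover have "thick_ideal K I" if "I \<in> \<C>" for I using c that by (auto simp: subset.chain_def)
  ultimately show ?thesis unfolding thick_ideal_iff using thick_idealD(4,5) by blast
qed

text \<open>An ideal \<open>P\<close> maximal among those containing \<open>I\<close> but not \<open>A\<close> is prime: if \<open>P\<close> contained a
  product of two ideals outside it, the two colons built from \<open>P\<close> and one of them would be
  strictly larger than \<open>P\<close> and hence contain \<open>A\<close>. Then \<open>A \<otimes> K \<otimes> A\<close> lies in \<open>P\<close>, and rigidity puts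
  \<open>A\<close> into \<open>P\<close>.\<close>

lemma rigid_ex_prime:
  assumes rigid: "left_rigid K \<or> right_rigid K"
    and I: "thick_ideal K I" and A: "A \<in> Ob K" "A \<notin> I"
  shows "\<exists>P\<in>Spc K. I \<subseteq> P \<and> A \<notin> P"
proof -
  let ?F = "{J. thick_ideal K J \<and> I \<subseteq> J \<and> A \<notin> J}"
  have "\<exists>M\<in>?F. \<forall>X\<in>?F. M \<subseteq> X \<longrightarrow> X = M"
  proof (rule subset_Zorn_nonempty)
    show "?F \<noteq> {}" using I A(2) by blast
    fix \<C> assume ne: "\<C> \<noteq> {}" and c: "subset.chain ?F \<C>"
    then have "subset.chain (Collect (thick_ideal K)) \<C>" by (auto simp: subset.chain_def)
    then have "thick_ideal K (\<Union>\<C>)" using thick_ideal_Union_chain ne by blast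
    moreover have "I \<subseteq> J \<and> A \<notin> J" if "J \<in> \<C>" for J
      using c that by (auto simp: subset.chain_def)
    then have "I \<subseteq> \<Union>\<C>" "A \<notin> \<Union>\<C>" using ne by blast+
    ultimately show "\<Union>\<C> \<in> ?F" by blast
  qed
  then obtain P where PF: "P \<in> ?F" and maxF: "\<forall>X\<in>?F. P \<subseteq> X \<longrightarrow> X = P" by (rule bexE)
  then have P: "thick_ideal K P" "I \<subseteq> P" "A \<notin> P" by simp_all
  have max: "X = P" if "thick_ideal K X" "P \<subseteq> X" "A \<notin> X" for X
    using maxF that P(2) by simp
  have PO: "P \<subseteq> Ob K" using thick_idealD(2)[OF P(1)] .
  have "J1 \<subseteq> P \<or> J2 \<subseteq> P"
    if J1: "thick_ideal K J1" and J2: "thick_ideal K J2" and J: "tensor_set K J1 J2 \<subseteq> P" for J1 J2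
  proof (rule ccontr)
    assume n: "\<not> ?thesis"
    let ?L = "left_colon K P J2"
    let ?R = "right_colon K P ?L"
    have JO: "J1 \<subseteq> Ob K" "J2 \<subseteq> Ob K"
      using thick_idealD(2)[OF J1] thick_idealD(2)[OF J2] .
    have L: "thick_ideal K ?L"
    proof (rule thick_ideal_left_colon[OF P(1) JO(2)])
      fix C Y assume CY: "C \<in> Ob K" "Y \<in> J2"
      have "C \<boxtimes> Y \<in> J2" using thick_idealD(5)[OF J2 CY(2,1)] .
      moreover from this have "isomorphic K (C \<boxtimes> Y) (C \<boxtimes> Y)" using isomorphic_refl JO(2) by auto
      ultimately show "\<exists>Y'\<in>J2. isomorphic K Y' (C \<boxtimes> Y)" by (rule bexI[rotated])
    qed
    have R: "thick_ideal K ?R" using thick_ideal_right_colon[OF P(1) L] .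
    have 1: "P \<subseteq> ?L"
    proof
      fix X assume X: "X \<in> P"
      then have "X \<boxtimes> Y \<in> P" if "Y \<in> J2" for Y using thick_idealD(4)[OF P(1) X] JO(2) that by blast
      then show "X \<in> ?L" using X PO by (simp add: left_colon_def subset_iff)
    qed
    have 2: "J1 \<subseteq> ?L" using J JO(1) unfolding left_colon_def tensor_set_def by blast
    have AL: "A \<in> ?L"
    proof (rule ccontr)
      assume "A \<notin> ?L"
      then have "?L = P" using max[OF L 1] by simp
      then show False using 2 n by simp
    qed
    have 3: "P \<subseteq> ?R"
    proof
      fix Y assume Y: "Y \<in> P"
      have "X \<boxtimes> Y \<in> P" if "X \<in> ?L" for X
        using thick_idealD(5)[OF P(1) Y] that by (simp add: left_colon_def)
      then show "Y \<in> ?R" using Y PO by (simp add: right_colon_def subset_iff)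
    qed
    have 4: "J2 \<subseteq> ?R" using JO(2) unfolding left_colon_def right_colon_def by blast
    have AR: "A \<in> ?R"
    proof (rule ccontr)
      assume "A \<notin> ?R"
      then have "?R = P" using max[OF R 3] by simp
      then show False using 4 n by simp
    qed
    have "(A \<boxtimes> C) \<boxtimes> A \<in> P" if "C \<in> Ob K" for C
      using thick_idealD(4)[OF L AL that] AR by (simp add: right_colon_def)
    then show False using rigid_semiprime[OF rigid P(1) A(1)] P(3) by blast
  qed
  then have "prime_ideal K P" using P A(1) unfolding prime_ideal_def by blast
  then show ?thesis using P by (auto simp: Spc_def)
qed

end

section \<open>Noetherian spectra\<close>

lemma noetherian_space_minimal:
  assumes X: "noetherian_space X" and cl: "\<And>C. C \<in> F \<Longrightarrow> closedin X C" and ne: "F \<noteq> {}"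
  obtains M where "M \<in> F" "\<And>D. D \<in> F \<Longrightarrow> D \<subseteq> M \<Longrightarrow> D = M"
proof (rule ccontr)
  assume "\<not> thesis"
  then have "\<forall>M\<in>F. \<exists>D\<in>F. D \<subset> M" using that by blast
  then obtain f where f: "\<And>M. M \<in> F \<Longrightarrow> f M \<in> F \<and> f M \<subset> M" by metis
  obtain C where C: "C \<in> F" using ne by blast
  define s where "s n = (f ^^ n) C" for n
  have s: "s n \<in> F" for n by (induction n) (use C f in \<open>auto simp: s_def\<close>)
  have lt: "s (Suc n) \<subset> s n" for n using f[OF s[of n]] by (simp add: s_def)
  then have "decseq s" by (intro decseq_SucI) auto
  then obtain N where "\<And>n. n \<ge> N \<Longrightarrow> s n = s N"
    using X cl[OF s] unfolding noetherian_space_def by blast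
  from this[of "Suc N"] lt[of N] show False by simp
qed

context monoidal_triangulated_category
begin

lemma closedin_support: "A \<in> Ob K \<Longrightarrow> closedin (Spc_topology K) {P \<in> Spc K. A \<notin> P}"
  unfolding closedin_Spc_topology Vset_def by (intro exI[of _ "{A}"]) auto

lemma closedin_specializations:
  assumes "P \<in> Spc K" shows "closedin (Spc_topology K) {Q \<in> Spc K. Q \<subseteq> P}"
  unfolding closedin_Spc_topology Vset_def
  by (intro exI[of _ "Ob K - P"]) (use SpcD(3) in blast)

text \<open>Take \<open>B \<notin> P\<close> with minimal support. For \<open>A \<notin> P\<close> some \<open>B \<otimes> C \<otimes> A\<close> lies outside \<open>P\<close>; its
  support is contained in that of \<open>B\<close>, so equal to it, and therefore contained in that of \<open>A\<close>.
  Thus the support of \<open>B\<close> is the intersection of the supports of all objects outside \<open>P\<close>, which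
  is the closure of the point \<open>P\<close>.\<close>

lemma noetherian_ex_point_support:
  assumes N: "noetherian_space (Spc_topology K)" and P: "P \<in> Spc K"
  obtains B where "B \<in> Ob K" "\<And>Q. Q \<in> Spc K \<Longrightarrow> B \<notin> Q \<longleftrightarrow> Q \<subseteq> P"
proof -
  let ?s = "\<lambda>A. {Q \<in> Spc K. A \<notin> Q}"
  obtain M where M: "M \<in> ?s ` (Ob K - P)"
    and min: "\<And>D. D \<in> ?s ` (Ob K - P) \<Longrightarrow> D \<subseteq> M \<Longrightarrow> D = M"
  proof (rule noetherian_space_minimal[OF N])
    show "closedin (Spc_topology K) C" if "C \<in> ?s ` (Ob K - P)" for C
      using closedin_support that by blast
    show "?s ` (Ob K - P) \<noteq> {}" using SpcD(2,3)[OF P] by blast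
  qed blast
  obtain B where B: "B \<in> Ob K" "B \<notin> P" "M = ?s B" using M by blast
  have "Q \<subseteq> P" if Q: "Q \<in> Spc K" "B \<notin> Q" for Q
  proof
    fix A assume A: "A \<in> Q"
    then have AO: "A \<in> Ob K" using SpcD(3)[OF Q(1)] by blast
    show "A \<in> P"
    proof (rule ccontr)
      assume "A \<notin> P"
      then obtain C where C: "C \<in> Ob K" "B \<boxtimes> (C \<boxtimes> A) \<notin> P"
        using prime_tensor_nonmem[OF P B(1,2) AO] by blast
      have CA: "C \<boxtimes> A \<in> Ob K" using Tob_Ob[OF C(1) AO] .
      have O: "B \<boxtimes> (C \<boxtimes> A) \<in> Ob K" using Tob_Ob[OF B(1) CA] .
      have "?s (B \<boxtimes> (C \<boxtimes> A)) \<subseteq> M"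
        using thick_idealD(4)[OF SpcD(1) _ CA] B(3) by blast
      then have "?s (B \<boxtimes> (C \<boxtimes> A)) = ?s B" using min O C(2) B(3) by blast
      then have "B \<boxtimes> (C \<boxtimes> A) \<notin> Q" using Q by blast
      then show False
        using thick_idealD(5)[OF SpcD(1)[OF Q(1)]] A B(1) C(1) by blast
    qed
  qed
  then show ?thesis using that[OF B(1)] B(2) by blast
qed

lemma noetherian_ex_minimal_prime:
  assumes N: "noetherian_space (Spc_topology K)" and X: "X \<subseteq> Spc K" "X \<noteq> {}"
  obtains P where "P \<in> X" "\<And>Q. Q \<in> X \<Longrightarrow> Q \<subseteq> P \<Longrightarrow> Q = P"
proof -
  let ?c = "\<lambda>P. {Q \<in> Spc K. Q \<subseteq> P}"
  obtain M where M: "M \<in> ?c ` X" and min: "\<And>D. D \<in> ?c ` X \<Longrightarrow> D \<subseteq> M \<Longrightarrow> D = M"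
  proof (rule noetherian_space_minimal[OF N])
    show "closedin (Spc_topology K) C" if "C \<in> ?c ` X" for C
      using closedin_specializations that X(1) by blast
    show "?c ` X \<noteq> {}" using X(2) by blast
  qed blast
  obtain P where P: "P \<in> X" "M = ?c P" using M by blast
  have "Q = P" if Q: "Q \<in> X" "Q \<subseteq> P" for Q
  proof -
    have "?c Q = ?c P" using min[of "?c Q"] Q P(2) by blast
    then show ?thesis using P(1) Q X(1) by blast
  qed
  then show ?thesis using that P(1) by blast
qed

end

section \<open>Translation of thick ideals by a group action\<close>

locale equivariant_mt_category = monoidal_triangulated_category K + group G +
  mt_group_action K G T \<gamma>
  for K :: "('o, 'm, 'z) mtcat_scheme" (structure)
    and G :: "('g, 'y) monoid_scheme"
    and T :: "'g \<Rightarrow> ('o, 'm) mtfun"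
    and \<gamma> :: "'g \<Rightarrow> 'g \<Rightarrow> 'o \<Rightarrow> 'm"
begin

lemma action_exact: "g \<in> carrier G \<Longrightarrow> exact_functor K (T g) (Fsh (T g))"
  using action_autoequivalence by (simp add: mt_autoequivalence_def mt_functor_def)

lemma action_endofunctor: "g \<in> carrier G \<Longrightarrow> endofunctor K (T g)"
  using action_exact by (simp add: exact_functor_def additive_functor_def)

lemma action_Ob: "g \<in> carrier G \<Longrightarrow> A \<in> Ob K \<Longrightarrow> Fo (T g) A \<in> Ob K"
  using action_endofunctor by (simp add: endofunctor_def)

lemma action_tensor:
  assumes "g \<in> carrier G" "A \<in> Ob K" "B \<in> Ob K"
  shows "isomorphic K (Fo (T g) A \<boxtimes> Fo (T g) B) (Fo (T g) (A \<boxtimes> B))"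
  using action_autoequivalence[OF assms(1)] assms(2,3)
  unfolding mt_autoequivalence_def mt_functor_def monoidal_functor_def isomorphic_def by blast

lemma action_mult:
  assumes "g \<in> carrier G" "h \<in> carrier G" "A \<in> Ob K"
  shows "isomorphic K (Fo (T g) (Fo (T h) A)) (Fo (T (g \<otimes>\<^bsub>G\<^esub> h)) A)"
proof -
  have "nat_iso K (mt_comp K (T g) (T h)) (T (g \<otimes>\<^bsub>G\<^esub> h)) (\<gamma> g h)"
    using action_nat_iso[OF assms(1,2)] by (simp add: mt_nat_iso_def)
  from nat_iso_isomorphic[OF this assms(3)] show ?thesis by (simp add: mt_comp_def)
qed

text \<open>The axioms give \<open>T\<^sub>1 T\<^sub>1 \<cong> T\<^sub>1\<close> only; cancelling one factor uses a quasi-inverse of \<open>T\<^sub>1\<close>.\<close>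

lemma action_one:
  assumes A: "A \<in> Ob K"
  shows "isomorphic K (Fo (T \<one>\<^bsub>G\<^esub>) A) A"
proof -
  let ?T = "T \<one>\<^bsub>G\<^esub>"
  have "autoequivalence K ?T"
    using action_autoequivalence by (simp add: mt_autoequivalence_def)
  then obtain F :: "('o, 'm) efun" and \<eta> where F: "endofunctor K F"
    and n: "nat_iso K fun_id (fun_comp F ?T) \<eta>"
    unfolding autoequivalence_def by blast
  have e: "isomorphic K X (Fo F (Fo ?T X))" if "X \<in> Ob K" for X
    using nat_iso_isomorphic[OF n that] by (simp add: fun_id_def fun_comp_def)
  have TA: "Fo ?T A \<in> Ob K" using action_Ob A by simp
  have "isomorphic K (Fo ?T (Fo ?T A)) (Fo ?T A)" using action_mult[of "\<one>\<^bsub>G\<^esub>" "\<one>\<^bsub>G\<^esub>"] A by simp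
  from endofunctor_isomorphic[OF F this]
  show ?thesis using e[OF A] e[OF TA] isomorphic_trans isomorphic_sym by blast
qed

text \<open>As \<open>T\<close> of the inverse of \<open>g\<close> is quasi-inverse to \<open>T\<^sub>g\<close>, the essential image of \<open>I\<close> under
  \<open>T\<^sub>g\<close> is a preimage. In this form translates are handled by equations instead of isomorphism
  witnesses.\<close>

lemma mem_translate_iff:
  assumes g: "g \<in> carrier G" and I: "thick_ideal K I"
  shows "B \<in> translate K T g I \<longleftrightarrow> B \<in> Ob K \<and> Fo (T (inv\<^bsub>G\<^esub> g)) B \<in> I"
proof
  assume "B \<in> translate K T g I"
  then obtain A where A: "A \<in> I" "isomorphic K (Fo (T g) A) B" unfolding translate_def by blast
  have AO: "A \<in> Ob K" using A(1) thick_idealD(2)[OF I] by blast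
  have ig: "inv\<^bsub>G\<^esub> g \<in> carrier G" using g by simp
  have "isomorphic K (Fo (T (inv\<^bsub>G\<^esub> g)) (Fo (T g) A)) A"
    using isomorphic_trans[OF action_mult[OF ig g AO]] action_one[OF AO] g by simp
  moreover have "isomorphic K (Fo (T (inv\<^bsub>G\<^esub> g)) (Fo (T g) A)) (Fo (T (inv\<^bsub>G\<^esub> g)) B)"
    using endofunctor_isomorphic[OF action_endofunctor[OF ig] A(2)] .
  ultimately have "isomorphic K A (Fo (T (inv\<^bsub>G\<^esub> g)) B)"
    using isomorphic_trans isomorphic_sym by blast
  then show "B \<in> Ob K \<and> Fo (T (inv\<^bsub>G\<^esub> g)) B \<in> I"
    using thick_idealD(3)[OF I A(1)] isomorphic_Ob[OF A(2)] by blast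
next
  assume B: "B \<in> Ob K \<and> Fo (T (inv\<^bsub>G\<^esub> g)) B \<in> I"
  have "isomorphic K (Fo (T g) (Fo (T (inv\<^bsub>G\<^esub> g)) B)) B"
    using isomorphic_trans[OF action_mult[of g "inv\<^bsub>G\<^esub> g" B]] action_one[of B] g B by simp
  then show "B \<in> translate K T g I" using B unfolding translate_def by blast
qed

lemma thick_ideal_translate:
  assumes g: "g \<in> carrier G" and I: "thick_ideal K I"
  shows "thick_ideal K (translate K T g I)"
proof -
  let ?T = "T (inv\<^bsub>G\<^esub> g)"
  have ig: "inv\<^bsub>G\<^esub> g \<in> carrier G" using g by simp
  have eq: "translate K T g I = {A \<in> Ob K. Fo ?T A \<in> I}" using mem_translate_iff[OF g I] by blast
  have "A \<boxtimes> B \<in> {A \<in> Ob K. Fo ?T A \<in> I} \<and> B \<boxtimes> A \<in> {A \<in> Ob K. Fo ?T A \<in> I}"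
    if "A \<in> {A \<in> Ob K. Fo ?T A \<in> I}" and B: "B \<in> Ob K" for A B
  proof -
    have A: "A \<in> Ob K" "Fo ?T A \<in> I" using that by auto
    have TB: "Fo ?T B \<in> Ob K" using action_Ob[OF ig B] .
    show ?thesis
      using thick_idealD(3)[OF I thick_idealD(4)[OF I A(2) TB] action_tensor[OF ig A(1) B]]
        thick_idealD(3)[OF I thick_idealD(5)[OF I A(2) TB] action_tensor[OF ig B A(1)]]
        Tob_Ob A(1) B by simp
  qed
  then show ?thesis
    unfolding thick_ideal_iff eq
    using thick_subcategory_preimage[OF action_exact[OF ig] thick_idealD(1)[OF I]] by blast
qed

lemma translate_mono: "I \<subseteq> J \<Longrightarrow> translate K T g I \<subseteq> translate K T g J"
  unfolding translate_def by blast

lemma translate_translate: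
  assumes g: "g \<in> carrier G" and h: "h \<in> carrier G" and I: "thick_ideal K I"
  shows "translate K T g (translate K T h I) = translate K T (g \<otimes>\<^bsub>G\<^esub> h) I"
proof -
  have "Fo (T (inv\<^bsub>G\<^esub> h)) (Fo (T (inv\<^bsub>G\<^esub> g)) B) \<in> I \<longleftrightarrow> Fo (T (inv\<^bsub>G\<^esub> (g \<otimes>\<^bsub>G\<^esub> h))) B \<in> I"
    if B: "B \<in> Ob K" for B
  proof -
    have i: "isomorphic K (Fo (T (inv\<^bsub>G\<^esub> h)) (Fo (T (inv\<^bsub>G\<^esub> g)) B)) (Fo (T (inv\<^bsub>G\<^esub> (g \<otimes>\<^bsub>G\<^esub> h))) B)"
      using action_mult[of "inv\<^bsub>G\<^esub> h" "inv\<^bsub>G\<^esub> g" B] g h B by (simp add: inv_mult_group)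
    show ?thesis using thick_idealD(3)[OF I _ i] thick_idealD(3)[OF I _ isomorphic_sym[OF i]] by blast
  qed
  moreover have "Fo (T (inv\<^bsub>G\<^esub> g)) B \<in> Ob K" if "B \<in> Ob K" for B using action_Ob g that by simp
  ultimately show ?thesis
    using mem_translate_iff[OF g thick_ideal_translate[OF h I]] mem_translate_iff[OF h I]
      mem_translate_iff[OF _ I, of "g \<otimes>\<^bsub>G\<^esub> h"] g h by auto
qed

lemma translate_one:
  assumes I: "thick_ideal K I" shows "translate K T \<one>\<^bsub>G\<^esub> I = I"
proof -
  have "Fo (T \<one>\<^bsub>G\<^esub>) B \<in> I \<longleftrightarrow> B \<in> I" if "B \<in> Ob K" for B
    using thick_idealD(3)[OF I _ action_one[OF that]]
      thick_idealD(3)[OF I _ isomorphic_sym[OF action_one[OF that]]] by blast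
  then show ?thesis using mem_translate_iff[OF _ I, of "\<one>\<^bsub>G\<^esub>"] thick_idealD(2)[OF I] by auto
qed

lemma translate_inv:
  assumes "g \<in> carrier G" "thick_ideal K I"
  shows "translate K T (inv\<^bsub>G\<^esub> g) (translate K T g I) = I"
    and "translate K T g (translate K T (inv\<^bsub>G\<^esub> g) I) = I"
  using translate_translate[of "inv\<^bsub>G\<^esub> g" g I] translate_translate[of g "inv\<^bsub>G\<^esub> g" I]
    translate_one assms by simp_all

lemma translate_subset_iff:
  assumes g: "g \<in> carrier G" and I: "thick_ideal K I" and J: "thick_ideal K J"
  shows "translate K T g I \<subseteq> J \<longleftrightarrow> I \<subseteq> translate K T (inv\<^bsub>G\<^esub> g) J"
  using translate_mono[of "translate K T g I" J "inv\<^bsub>G\<^esub> g"]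
    translate_mono[of I "translate K T (inv\<^bsub>G\<^esub> g) J" g] translate_inv[OF g] I J by auto

lemma translate_tensor_set:
  assumes g: "g \<in> carrier G" and I: "thick_ideal K I" and J: "thick_ideal K J"
    and P: "thick_ideal K P" and IJ: "tensor_set K I J \<subseteq> P"
  shows "tensor_set K (translate K T g I) (translate K T g J) \<subseteq> translate K T g P"
proof
  let ?T = "T (inv\<^bsub>G\<^esub> g)"
  fix X assume "X \<in> tensor_set K (translate K T g I) (translate K T g J)"
  then obtain A B where X: "X = A \<boxtimes> B" and A: "A \<in> Ob K" "Fo ?T A \<in> I" and B: "B \<in> Ob K" "Fo ?T B \<in> J"
    using mem_translate_iff[OF g I] mem_translate_iff[OF g J] unfolding tensor_set_def by blast
  have "Fo ?T A \<boxtimes> Fo ?T B \<in> P" using A B IJ unfolding tensor_set_def by blast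
  then have "Fo ?T (A \<boxtimes> B) \<in> P"
    using thick_idealD(3)[OF P] action_tensor[of "inv\<^bsub>G\<^esub> g" A B] A B g by simp
  then show "X \<in> translate K T g P" using mem_translate_iff[OF g P] Tob_Ob A B X by blast
qed

lemma Spc_translate:
  assumes g: "g \<in> carrier G" and P: "P \<in> Spc K"
  shows "translate K T g P \<in> Spc K"
proof -
  note tP = SpcD(1)[OF P]
  have ig: "inv\<^bsub>G\<^esub> g \<in> carrier G" using g by simp
  have tgP: "thick_ideal K (translate K T g P)" using thick_ideal_translate[OF g tP] .
  have "translate K T g P \<noteq> Ob K"
  proof
    assume *: "translate K T g P = Ob K"
    have "B \<in> P" if B: "B \<in> Ob K" for B
    proof -
      have "Fo (T g) B \<in> translate K T g P" using * action_Ob[OF g B] by simp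
      then have "B \<in> translate K T (inv\<^bsub>G\<^esub> g) (translate K T g P)"
        using mem_translate_iff[OF ig tgP] g B by simp
      then show ?thesis using translate_inv(1)[OF g tP] by simp
    qed
    then show False using SpcD(2,3)[OF P] by blast
  qed
  moreover have "I \<subseteq> translate K T g P \<or> J \<subseteq> translate K T g P"
    if I: "thick_ideal K I" and J: "thick_ideal K J" and IJ: "tensor_set K I J \<subseteq> translate K T g P" for I J
  proof -
    have "tensor_set K (translate K T (inv\<^bsub>G\<^esub> g) I) (translate K T (inv\<^bsub>G\<^esub> g) J) \<subseteq> P"
      using translate_tensor_set[OF ig I J tgP IJ] translate_inv(1)[OF g tP] by simp
    then have "translate K T (inv\<^bsub>G\<^esub> g) I \<subseteq> P \<or> translate K T (inv\<^bsub>G\<^esub> g) J \<subseteq> P"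
      using SpcD(4)[OF P] thick_ideal_translate[OF ig] I J by blast
    then show ?thesis using translate_subset_iff[OF ig _ tP] I J g by simp
  qed
  ultimately show ?thesis using tgP unfolding Spc_def prime_ideal_def by blast
qed

text \<open>An intersection of thick ideals is a \<open>G\<close>-ideal as soon as \<open>G\<close> permutes the family. The
  restriction to objects matters for the empty family.\<close>

lemma G_ideal_Inter:
  assumes X: "\<And>I. I \<in> X \<Longrightarrow> thick_ideal K I"
    and perm: "\<And>g I. g \<in> carrier G \<Longrightarrow> I \<in> X \<Longrightarrow> translate K T g I \<in> X"
  shows "G_ideal K G T {A \<in> Ob K. \<forall>I\<in>X. A \<in> I}"
proof -
  let ?J = "{A \<in> Ob K. \<forall>I\<in>X. A \<in> I}"
  have J: "thick_ideal K ?J" using X by (rule thick_ideal_Inter)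
  have "translate K T g ?J \<subseteq> ?J" if g: "g \<in> carrier G" for g
  proof -
    have "translate K T g ?J \<subseteq> I" if I: "I \<in> X" for I
    proof -
      have "?J \<subseteq> translate K T (inv\<^bsub>G\<^esub> g) I" using perm[OF _ I] g by blast
      then show ?thesis using translate_subset_iff[OF g J X[OF I]] by blast
    qed
    moreover have "translate K T g ?J \<subseteq> Ob K" using thick_idealD(2)[OF thick_ideal_translate[OF g J]] .
    ultimately show ?thesis by blast
  qed
  then show ?thesis using J by (simp add: G_ideal_def)
qed

lemma G_ideal_G_core:
  assumes I: "thick_ideal K I" shows "G_ideal K G T (G_core K G T I)"
proof -
  let ?X = "(\<lambda>g. translate K T g I) ` carrier G"
  have "G_ideal K G T {A \<in> Ob K. \<forall>J\<in>?X. A \<in> J}"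
    by (rule G_ideal_Inter) (use thick_ideal_translate I translate_translate in auto)
  moreover have "{A \<in> Ob K. \<forall>J\<in>?X. A \<in> J} = G_core K G T I"
    using thick_idealD(2)[OF thick_ideal_translate[OF one_closed I]] one_closed
    unfolding G_core_def by blast
  ultimately show ?thesis by simp
qed

lemma G_core_subset:
  assumes "thick_ideal K I" shows "G_core K G T I \<subseteq> I"
  using translate_one[OF assms] one_closed unfolding G_core_def by blast

lemma G_core_greatest:
  assumes J: "G_ideal K G T J" and I: "thick_ideal K I" and JI: "J \<subseteq> I"
  shows "J \<subseteq> G_core K G T I"
proof -
  have "J \<subseteq> translate K T g I" if g: "g \<in> carrier G" for g
  proof -
    have "translate K T (inv\<^bsub>G\<^esub> g) J \<subseteq> I" using J JI g unfolding G_ideal_def by blast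
    then show ?thesis using translate_subset_iff[of "inv\<^bsub>G\<^esub> g" J I] J I g by (simp add: G_ideal_def)
  qed
  then show ?thesis unfolding G_core_def by blast
qed

lemma G_core_translate:
  assumes h: "h \<in> carrier G" and I: "thick_ideal K I"
  shows "G_core K G T (translate K T h I) = G_core K G T I"
proof -
  have "g \<in> (\<lambda>g. g \<otimes>\<^bsub>G\<^esub> h) ` carrier G" if "g \<in> carrier G" for g
    using that h by (intro image_eqI[of _ _ "g \<otimes>\<^bsub>G\<^esub> inv\<^bsub>G\<^esub> h"]) (simp_all add: m_assoc)
  then have "(\<lambda>g. g \<otimes>\<^bsub>G\<^esub> h) ` carrier G = carrier G" using h by blast
  then have "(\<Inter>g\<in>carrier G. translate K T g I) = (\<Inter>g\<in>carrier G. translate K T (g \<otimes>\<^bsub>G\<^esub> h) I)"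
    using image_image[of "\<lambda>g. translate K T g I" "\<lambda>g. g \<otimes>\<^bsub>G\<^esub> h" "carrier G"] by simp
  then show ?thesis unfolding G_core_def using translate_translate[OF _ h I] by simp
qed

lemma G_prime_G_core:
  assumes P: "P \<in> Spc K" shows "G_prime K G T (G_core K G T P)"
  unfolding G_prime_def
proof (intro conjI allI impI)
  note tP = SpcD(1)[OF P]
  show "G_ideal K G T (G_core K G T P)" using G_ideal_G_core[OF tP] .
  show "G_core K G T P \<noteq> Ob K" using G_core_subset[OF tP] SpcD(2,3)[OF P] by blast
  fix I J assume *: "G_ideal K G T I \<and> G_ideal K G T J \<and> tensor_set K I J \<subseteq> G_core K G T P"
  then have "thick_ideal K I" "thick_ideal K J" "tensor_set K I J \<subseteq> P"
    using G_core_subset[OF tP] by (auto simp: G_ideal_def)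
  then have "I \<subseteq> P \<or> J \<subseteq> P" using SpcD(4)[OF P] by simp
  then show "I \<subseteq> G_core K G T P \<or> J \<subseteq> G_core K G T P" using G_core_greatest[OF _ tP] * by blast
qed

section \<open>Fibres and image of the core map\<close>

text \<open>The inclusion iterates to a descending chain of primes, which becomes stationary; since
  translation by \<open>k\<close> is injective, equality at a late step propagates back to the first.\<close>

lemma noetherian_translate_eq:
  assumes N: "noetherian_space (Spc_topology K)" and P: "P \<in> Spc K"
    and k: "k \<in> carrier G" and le: "translate K T k P \<subseteq> P"
  shows "translate K T k P = P"
proof -
  let ?f = "translate K T k"
  let ?X = "{(?f ^^ n) P | n. True}"
  have X: "?X \<subseteq> Spc K"
  proof -
    have "(?f ^^ n) P \<in> Spc K" for n by (induction n) (use P Spc_translate[OF k] in auto)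
    then show ?thesis by blast
  qed
  have dec: "(?f ^^ Suc n) P \<subseteq> (?f ^^ n) P" for n
    by (induction n) (use le translate_mono in auto)
  obtain M where "M \<in> ?X" and min: "\<And>Q. Q \<in> ?X \<Longrightarrow> Q \<subseteq> M \<Longrightarrow> Q = M"
    using noetherian_ex_minimal_prime[OF N X] by blast
  then obtain n where n: "M = (?f ^^ n) P" by blast
  have "(?f ^^ Suc n) P \<in> ?X" by blast
  then have eq: "(?f ^^ Suc n) P = (?f ^^ n) P" using min dec[of n] n by simp
  have th: "thick_ideal K ((?f ^^ n) P)" for n using X SpcD(1) by blast
  have "(?f ^^ Suc m) P = (?f ^^ m) P \<Longrightarrow> ?f P = P" for m
  proof (induction m)
    case (Suc m)
    then have "translate K T (inv\<^bsub>G\<^esub> k) (?f ((?f ^^ Suc m) P)) = translate K T (inv\<^bsub>G\<^esub> k) (?f ((?f ^^ m) P))"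
      by simp
    then have "(?f ^^ Suc m) P = (?f ^^ m) P" using translate_inv(1)[OF k] th by metis
    then show ?case using Suc.IH by blast
  qed simp
  then show ?thesis using eq by blast
qed

text \<open>An object supported exactly on the primes contained in \<open>P\<close> lies outside \<open>P\<close>, hence outside
  some member of the intersection that defines \<open>(Q : G)\<close>, and this member lies in its support.\<close>

lemma noetherian_translate_below:
  assumes N: "noetherian_space (Spc_topology K)" and P: "P \<in> Spc K" and Q: "Q \<in> Spc K"
    and le: "G_core K G T Q \<subseteq> P"
  shows "\<exists>g\<in>carrier G. translate K T g Q \<subseteq> P"
proof -
  obtain B where B: "B \<in> Ob K" "\<And>R. R \<in> Spc K \<Longrightarrow> B \<notin> R \<longleftrightarrow> R \<subseteq> P"
    using noetherian_ex_point_support[OF N P] by blast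
  have "B \<notin> G_core K G T Q" using B(2)[OF P] le by blast
  then obtain g where "g \<in> carrier G" "B \<notin> translate K T g Q" unfolding G_core_def by blast
  then show ?thesis using B(2) Spc_translate Q by blast
qed

lemma noetherian_G_core_eq:
  assumes N: "noetherian_space (Spc_topology K)" and P: "P \<in> Spc K" and Q: "Q \<in> Spc K"
    and eq: "G_core K G T P = G_core K G T Q"
  shows "\<exists>g\<in>carrier G. translate K T g P = Q"
proof -
  note tP = SpcD(1)[OF P] and tQ = SpcD(1)[OF Q]
  obtain g where g: "g \<in> carrier G" "translate K T g Q \<subseteq> P"
    using noetherian_translate_below[OF N P Q] eq G_core_subset[OF tP] by auto
  obtain h where h: "h \<in> carrier G" "translate K T h P \<subseteq> Q"
    using noetherian_translate_below[OF N Q P] eq G_core_subset[OF tQ] by auto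
  have hg: "translate K T (h \<otimes>\<^bsub>G\<^esub> g) Q \<subseteq> translate K T h P"
    using translate_mono[OF g(2), of h] translate_translate[OF h(1) g(1) tQ] by simp
  have "translate K T (h \<otimes>\<^bsub>G\<^esub> g) Q = Q"
    using noetherian_translate_eq[OF N Q] hg h g(1) by blast
  then show ?thesis using hg h by blast
qed

text \<open>Let \<open>P\<close> be minimal among the primes containing \<open>Q\<close>, and divide these primes into those that
  contain a translate of \<open>P\<close>, hence \<open>(P : G)\<close>, and the others, with intersection \<open>I\<close>. Then
  \<open>I \<otimes> (P : G)\<close> lies in every prime containing \<open>Q\<close>, so in \<open>Q\<close> by rigidity. The factor \<open>I\<close> does
  not lie in \<open>Q\<close>: an object supported exactly on the primes contained in \<open>P\<close> is missed, among the
  primes containing \<open>Q\<close>, by the minimal one \<open>P\<close> only, so it is in \<open>I\<close> but not in \<open>Q\<close>.\<close>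

lemma noetherian_G_prime_core:
  assumes rigid: "left_rigid K \<or> right_rigid K" and N: "noetherian_space (Spc_topology K)"
    and Q: "G_prime K G T Q"
  shows "\<exists>P\<in>Spc K. G_core K G T P = Q"
proof -
  have GQ: "G_ideal K G T Q" and tQ: "thick_ideal K Q" and "Q \<noteq> Ob K"
    using Q by (auto simp: G_prime_def G_ideal_def)
  then have QO: "Q \<subseteq> Ob K" "Q \<noteq> Ob K" using thick_idealD(2)[OF tQ] by simp_all
  let ?X = "{P \<in> Spc K. Q \<subseteq> P}"
  have ne: "?X \<noteq> {}"
  proof -
    obtain A where "A \<in> Ob K" "A \<notin> Q" using QO by blast
    then show ?thesis using rigid_ex_prime[OF rigid tQ] by blast
  qed
  obtain P where PX: "P \<in> ?X" and min: "\<And>R. R \<in> ?X \<Longrightarrow> R \<subseteq> P \<Longrightarrow> R = P"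
  proof (rule noetherian_ex_minimal_prime[OF N _ ne])
    show "?X \<subseteq> Spc K" by simp
  qed blast
  have P: "P \<in> Spc K" "Q \<subseteq> P" using PX by simp_all
  note tP = SpcD(1)[OF P(1)]
  let ?Y = "{R \<in> ?X. \<forall>g\<in>carrier G. \<not> translate K T g P \<subseteq> R}"
  let ?I = "{A \<in> Ob K. \<forall>R\<in>?Y. A \<in> R}"
  have GI: "G_ideal K G T ?I"
  proof (rule G_ideal_Inter)
    fix g R assume g: "g \<in> carrier G" and R: "R \<in> ?Y"
    have RS: "R \<in> Spc K" "Q \<subseteq> R" using R by auto
    note tR = SpcD(1)[OF RS(1)]
    have ig: "inv\<^bsub>G\<^esub> g \<in> carrier G" using g by simp
    have "Q \<subseteq> translate K T g R"
      using G_core_greatest[OF GQ tR RS(2)] g unfolding G_core_def by blast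
    moreover have "\<not> translate K T h P \<subseteq> translate K T g R" if h: "h \<in> carrier G" for h
    proof -
      have "\<not> translate K T (inv\<^bsub>G\<^esub> g \<otimes>\<^bsub>G\<^esub> h) P \<subseteq> R" using R ig h by blast
      then show ?thesis
        using translate_subset_iff[OF ig thick_ideal_translate[OF h tP] tR]
          translate_translate[OF ig h tP] g by simp
    qed
    ultimately show "translate K T g R \<in> ?Y" using Spc_translate[OF g RS(1)] by blast
  qed (use SpcD(1) in blast)
  have "tensor_set K ?I (G_core K G T P) \<subseteq> Q"
  proof
    fix Z assume "Z \<in> tensor_set K ?I (G_core K G T P)"
    then obtain A B where Z: "Z = A \<boxtimes> B" and A: "A \<in> ?I" and B: "B \<in> G_core K G T P"
      unfolding tensor_set_def by blast
    have O: "A \<in> Ob K" "B \<in> Ob K" using A B G_core_subset[OF tP] SpcD(3)[OF P(1)] by auto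
    have "Z \<in> R" if R: "R \<in> ?X" for R
    proof (cases "R \<in> ?Y")
      case True
      then have "A \<in> R" using A by blast
      then show ?thesis using thick_idealD(4)[OF SpcD(1)[of R K], of A B] R O Z by simp
    next
      case False
      then have "B \<in> R" using R B unfolding G_core_def by blast
      then show ?thesis using thick_idealD(5)[OF SpcD(1)[of R K], of B A] R O Z by simp
    qed
    then show "Z \<in> Q" using rigid_ex_prime[OF rigid tQ Tob_Ob[OF O]] Z by blast
  qed
  then have "?I \<subseteq> Q \<or> G_core K G T P \<subseteq> Q"
    using Q GI G_ideal_G_core[OF tP] unfolding G_prime_def by blast
  moreover have "\<not> ?I \<subseteq> Q"
  proof -
    obtain B where B: "B \<in> Ob K" "\<And>R. R \<in> Spc K \<Longrightarrow> B \<notin> R \<longleftrightarrow> R \<subseteq> P"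
      using noetherian_ex_point_support[OF N P(1)] by blast
    have "P \<notin> ?Y" using translate_one[OF tP] one_closed by blast
    then have "B \<in> ?I" using B min by blast
    moreover have "B \<notin> Q" using B(2)[OF P(1)] P(2) by blast
    ultimately show ?thesis by blast
  qed
  ultimately show ?thesis using P(1) G_core_greatest[OF GQ tP P(2)] by blast
qed

lemma orbit_translate_eq:
  assumes P: "thick_ideal K P" and h: "h \<in> carrier G"
  shows "orbit G (translate K T) (translate K T h P) = orbit G (translate K T) P"
proof (intro subset_antisym subsetI)
  fix R assume "R \<in> orbit G (translate K T) (translate K T h P)"
  then obtain g where "g \<in> carrier G" "R = translate K T (g \<otimes>\<^bsub>G\<^esub> h) P"
    using translate_translate[OF _ h P] unfolding orbit_def by blast
  then show "R \<in> orbit G (translate K T) P" using h unfolding orbit_def by blast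
next
  fix R assume "R \<in> orbit G (translate K T) P"
  then obtain g where g: "g \<in> carrier G" "R = translate K T g P" unfolding orbit_def by blast
  then have "R = translate K T (g \<otimes>\<^bsub>G\<^esub> inv\<^bsub>G\<^esub> h) (translate K T h P)"
    using translate_translate[OF _ h P, of "g \<otimes>\<^bsub>G\<^esub> inv\<^bsub>G\<^esub> h"] h by (simp add: m_assoc)
  moreover have "g \<otimes>\<^bsub>G\<^esub> inv\<^bsub>G\<^esub> h \<in> carrier G" using g(1) h by simp
  ultimately show "R \<in> orbit G (translate K T) (translate K T h P)" unfolding orbit_def by blast
qed

lemma c2_orbit:
  assumes P: "P \<in> Spc K"
  shows "c2 K G T (orbit G (translate K T) P) = G_core K G T P"
proof -
  have "G_core K G T ` orbit G (translate K T) P = {G_core K G T P}"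
    unfolding orbit_def using G_core_translate[OF _ SpcD(1)[OF P]] one_closed by blast
  then show ?thesis by (simp add: c2_def)
qed

end

theorem proposition7p2:
  fixes K :: "('o, 'm) mtcat"
    and G :: "'g monoid"
    and T :: "'g \<Rightarrow> ('o, 'm) mtfun"
    and \<gamma> :: "'g \<Rightarrow> 'g \<Rightarrow> 'o \<Rightarrow> 'm"
  assumes "monoidal_triangulated_category K"
    and "group G"
    and "mt_group_action K G T \<gamma>"
    and "left_rigid K \<or> right_rigid K"
    and "noetherian_space (Spc_topology K)"
  shows "(\<forall>P\<in>Spc K. c2 K G T (orbit G (translate K T) P) = G_core K G T P) \<and>
         bij_betw (c2 K G T) (orbits G (Spc K) (translate K T)) (G_Spc K G T)"
proof -
  interpret equivariant_mt_category K G T \<gamma>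
    using assms(1,2,3) by (simp add: equivariant_mt_category_def)
  note rigid = assms(4) and N = assms(5)
  have "inj_on (c2 K G T) (orbits G (Spc K) (translate K T))"
  proof (rule inj_onI)
    fix X Y assume "X \<in> orbits G (Spc K) (translate K T)" "Y \<in> orbits G (Spc K) (translate K T)"
      and eq: "c2 K G T X = c2 K G T Y"
    then obtain P Q where P: "P \<in> Spc K" "X = orbit G (translate K T) P"
      and Q: "Q \<in> Spc K" "Y = orbit G (translate K T) Q" unfolding orbits_def by blast
    then have "G_core K G T P = G_core K G T Q" using eq c2_orbit by simp
    then obtain g where "g \<in> carrier G" "translate K T g P = Q"
      using noetherian_G_core_eq[OF N P(1) Q(1)] by blast
    then show "X = Y" using orbit_translate_eq[OF SpcD(1)[OF P(1)]] P Q by blast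
  qed
  moreover have "c2 K G T ` orbits G (Spc K) (translate K T) = G_core K G T ` Spc K"
    unfolding orbits_def using c2_orbit by (force simp: image_iff)
  moreover have "G_core K G T ` Spc K = G_Spc K G T"
    using G_prime_G_core noetherian_G_prime_core[OF rigid N] unfolding G_Spc_def by blast
  ultimately show ?thesis using c2_orbit by (simp add: bij_betw_def)
qed

end
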